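(* Let $m\in\mathbf{N}=\{0,1,2,\dots\}$. There exist a family $(\omega_\mu)_{\mu\ge 0}$ (indexed by real numbers $\mu\geq 0$) of smooth $\mathbf{S}^1$-invariant volume forms on $\mathbf{P}^1$ with $\int_{\mathbf{P}^1}\omega_\mu=1$, and a family $(h_{\omega_\mu})_{\mu\ge 0}$ of smooth $\mathbf{S}^1$-invariant hermitian metrics on $\mathcal{O}(m)$, such that $$\lim_{\mu\to\infty}\ \sup_{x\in\,]0,1[}\frac{\overline{g}_{\omega_\mu}(x)\,\overline{h}_{\omega_\mu}(x)}{\overline{g}_{can}(x)\,\overline{h}_{m,\infty}(x)}=\infty\qquad\text{and}\qquad \lim_{\mu\to\infty}\lambda_1(\omega_\mu,h_{\omega_\mu})=\infty ,$$ where $\overline{g}_{can}(x)=2\min(x,1-x)$, $\overline{h}_{m,\infty}(x)=\min(1,2(1-x))^m$, $\overline h_{\omega_\mu}$ is the function attached to the metric $h_{\omega_\mu}$ and the volume form $\omega_\mu$, and $\lambda_1(\omega_\mu,h_{\omega_\mu})$ is the first positive invariant eigenvalue of $\Delta_{\omega_\mu,h_{\omega_\mu}}$.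
   Context: Coordinates. $[x_0:x_1]$ are homogeneous coordinates on $\mathbf{P}^1$ (the complex projective line), $z=x_1/x_0$ is the affine coordinate on $\mathbf{C}=\{x_0\neq 0\}$. $\mathbf{S}^1$ acts by $z\mapsto e^{i\theta}z$; "invariant" means $\mathbf{S}^1$-invariant. Volume forms are positive everywhere. On $\mathbf{C}^\ast$ write $z=e^{-u}e^{i\theta}$ with $u\in\mathbf{R}$, $\theta\in\mathbf{R}/2\pi\mathbf{Z}$. The global section $x_0^m$ of $\mathcal{O}(m)$ is denoted $1$. Symplectic coordinates. Let $\omega$ be an invariant volume form of total mass $1$. There is an invariant hermitian metric $\|\cdot\|_\omega$ on $\mathcal{O}(1)$ with $c_1(\mathcal{O}(1),\|\cdot\|_\omega)=\omega$; put $F_\omega(u)=\log\|1\|_\omega(e^{-u})$, where here $1=x_0$. Then $\omega$ has density $-\frac{1}{2\pi}F_\omega''(u)$ with respect to the measure $du\,d\theta$ on $\mathbf{C}^\ast$, $F_\omega$ is strictly concave, and $F_\omega'$ is a decreasing bijection from $\mathbf{R}$ onto $]0,1[$ with $F_\omega'(+\infty)=0$, $F_\omega'(-\infty)=1$ (equivalently $F'_\omega(u)=\omega(\{|z|<e^{-u}\})$). Let $G_\omega:\,]0,1[\to\mathbf{R}$ be the inverse of $F_\omega'$, and set $$\overline{g}_\omega(x)=\frac{1}{-G_\omega'(x)}=-F_\omega''(G_\omega(x)),\qquad x\in\,]0,1[ .$$ For an invariant hermitian metric $h$ on $\mathcal{O}(m)$ set $\overline{h}_\omega(x)=h(1,1)(e^{-G_\omega(x)})$,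 $x\in\,]0,1[$, i.e. $h(1,1)$ evaluated at the point $z=e^{-G_\omega(x)}$. Laplacian. $A^{(0,q)}(\mathbf{P}^1,\mathcal{O}(m))$ denotes the space of smooth $(0,q)$-forms with values in $\mathcal{O}(m)$. On $A^{(0,0)}$ use the $L^2$ product $(s,t)_{\omega,h}=\int_{\mathbf{P}^1}h(s,t)\,\omega$; on $A^{(0,1)}$ use the product whose square norm on $\overline\partial s$ is $\frac{i}{2\pi}\int h\bigl(\frac{\partial s}{\partial\overline z},\frac{\partial s}{\partial\overline z}\bigr)dz\wedge d\overline z$. Then $\Delta_{\omega,h}=\overline\partial^\ast_{\mathcal{O}(m)}\overline\partial_{\mathcal{O}(m)}$ acting on $A^{(0,0)}(\mathbf{P}^1,\mathcal{O}(m))$; it has a self-adjoint extension with discrete nonnegative spectrum. An invariant element of $A^{(0,0)}(\mathbf{P}^1,\mathcal{O}(m))$ is one of the form $f\otimes 1$ on $\mathbf{C}$ with $f$ an $\mathbf{S}^1$-invariant function. The invariant eigenvalues are the eigenvalues of $\Delta_{\omega,h}$ that admit a nonzero invariant eigensection, listed in increasing order $0=\lambda_0(\omega,h)<\lambda_1(\omega,h)<\cdots$. *)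

theory Defs
  imports "HOL-Analysis.Analysis"
begin

section \<open>Smooth functions and Wirtinger derivatives\<close>

text \<open>Smoothness is real smoothness, also for functions on the complex plane.\<close>

primrec Ck :: "nat \<Rightarrow> ('a::real_normed_vector \<Rightarrow> 'b::real_normed_vector) \<Rightarrow> bool" where
  "Ck 0 = (\<lambda>f. continuous_on UNIV f)"
| "Ck (Suc k) = (\<lambda>f. \<exists>f'. (\<forall>x. (f has_derivative f' x) (at x)) \<and> (\<forall>v. Ck k (\<lambda>x. f' x v)))"

definition smooth :: "('a::euclidean_space \<Rightarrow> 'b::real_normed_vector) \<Rightarrow> bool" where
  "smooth f \<longleftrightarrow> (\<forall>k. Ck k f)"

definition d_z :: "(complex \<Rightarrow> complex) \<Rightarrow> complex \<Rightarrow> complex" where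
  "d_z f z = (frechet_derivative f (at z) 1 - \<i> * frechet_derivative f (at z) \<i>) / 2"

definition d_zbar :: "(complex \<Rightarrow> complex) \<Rightarrow> complex \<Rightarrow> complex" where
  "d_zbar f z = (frechet_derivative f (at z) 1 + \<i> * frechet_derivative f (at z) \<i>) / 2"


section \<open>Tensors on the projective line\<close>

text \<open>
  The projective line is covered by the charts \<open>z = x1/x0\<close> and \<open>w = x0/x1 = 1/z\<close>, each with
  range the whole complex plane.  A smooth tensor is represented by its component in the
  chart \<open>z\<close>; it must be smooth there, and its component in the chart \<open>w\<close>, which the transition
  rule gives for nonzero \<open>w\<close>, must extend smoothly (and, where required, positively) to \<open>w = 0\<close>.
  The point at infinity is a null set, so integrals over the projective line are integrals
  over the chart \<open>z\<close>.
\<close>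

text \<open>
  A volume form is represented by its density \<open>\<rho>\<close> with respect to Lebesgue measure \<open>dx dy\<close>;
  one has \<open>dx dy = |w|^(-4) du dv\<close> for \<open>z = x + iy\<close>, \<open>w = u + iv\<close>.
\<close>

definition volume_form :: "(complex \<Rightarrow> real) \<Rightarrow> bool" where
  "volume_form \<rho> \<longleftrightarrow> smooth \<rho> \<and> (\<forall>z. \<rho> z > 0) \<and>
     (\<exists>\<sigma>. smooth \<sigma> \<and> (\<forall>w. \<sigma> w > 0) \<and> (\<forall>w. w \<noteq> 0 \<longrightarrow> \<sigma> w = \<rho> (1 / w) / norm w ^ 4))"

definition total_mass :: "(complex \<Rightarrow> real) \<Rightarrow> real" where
  "total_mass \<rho> = (LINT z|lborel. \<rho> z)"

text \<open>
  A hermitian metric on \<open>O(m)\<close> is represented by the function \<open>h(1,1)\<close>, where \<open>1 = x0^m\<close>.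
  In the chart \<open>w\<close> the frame is \<open>x1^m = w^(-m) x0^m\<close>.
\<close>

definition hermitian_metric :: "nat \<Rightarrow> (complex \<Rightarrow> real) \<Rightarrow> bool" where
  "hermitian_metric m h \<longleftrightarrow> smooth h \<and> (\<forall>z. h z > 0) \<and>
     (\<exists>k. smooth k \<and> (\<forall>w. k w > 0) \<and> (\<forall>w. w \<noteq> 0 \<longrightarrow> k w = h (1 / w) / norm w ^ (2 * m)))"

text \<open>
  A section of \<open>O(m)\<close> is represented by the function \<open>f\<close> such that it equals \<open>f x0^m\<close>
  in the chart \<open>z\<close>, hence \<open>w^m f(1/w) x1^m\<close> in the chart \<open>w\<close>.
\<close>

definition A00 :: "nat \<Rightarrow> (complex \<Rightarrow> complex) set" where
  "A00 m = {f. smooth f \<and> (\<exists>g. smooth g \<and> (\<forall>w. w \<noteq> 0 \<longrightarrow> g w = w ^ m * f (1 / w)))}"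

text \<open>
  In these representations (densities, metrics, sections), rotations act by composition:
  they preserve \<open>dx dy\<close> and the section \<open>x0^m\<close>.
\<close>

definition S1_invariant :: "(complex \<Rightarrow> 'a) \<Rightarrow> bool" where
  "S1_invariant f \<longleftrightarrow> (\<forall>\<theta>::real. \<forall>z. f (cis \<theta> * z) = f z)"


section \<open>Symplectic coordinates\<close>

text \<open>
  The first Chern form of a metric \<open>k\<close> on a line bundle with frame \<open>1\<close> is
  \<open>- i/(2 pi) d dbar log k(1,1)\<close>, and \<open>i dz dzbar = 2 dx dy\<close>.
\<close>

definition chern_form :: "(complex \<Rightarrow> real) \<Rightarrow> complex \<Rightarrow> real" where
  "chern_form k z = - Re (d_z (d_zbar (\<lambda>z. complex_of_real (ln (k z)))) z) / pi"

definition potential_metric :: "(complex \<Rightarrow> real) \<Rightarrow> complex \<Rightarrow> real" where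
  "potential_metric \<rho> =
     (SOME k. hermitian_metric 1 k \<and> S1_invariant k \<and> (\<forall>z. chern_form k z = \<rho> z))"

text \<open>The metric is determined up to a positive constant, which does not affect the derivative
  of the following function.\<close>

definition F_pot :: "(complex \<Rightarrow> real) \<Rightarrow> real \<Rightarrow> real" where
  "F_pot \<rho> u = ln (sqrt (potential_metric \<rho> (of_real (exp (- u)))))"

definition G_inv :: "(complex \<Rightarrow> real) \<Rightarrow> real \<Rightarrow> real" where
  "G_inv \<rho> = inv_into UNIV (deriv (F_pot \<rho>))"

definition gbar :: "(complex \<Rightarrow> real) \<Rightarrow> real \<Rightarrow> real" where
  "gbar \<rho> x = 1 / (- deriv (G_inv \<rho>) x)"

definition hbar :: "(complex \<Rightarrow> real) \<Rightarrow> (complex \<Rightarrow> real) \<Rightarrow> real \<Rightarrow> real" where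
  "hbar \<rho> h x = h (of_real (exp (- G_inv \<rho> x)))"

definition gbar_can :: "real \<Rightarrow> real" where
  "gbar_can x = 2 * min x (1 - x)"

definition hbar_inf :: "nat \<Rightarrow> real \<Rightarrow> real" where
  "hbar_inf m x = (min 1 (2 * (1 - x))) ^ m"


section \<open>The Laplacian and its invariant eigenvalues\<close>

text \<open>
  The \<open>L2\<close> products on sections \<open>s = f x0^m\<close> and on \<open>(0,1)\<close>-forms \<open>\<eta> dzbar x0^m\<close>;
  in the second, \<open>i/(2 pi) dz dzbar = (1/pi) dx dy\<close>.
\<close>

definition inner_00 ::
    "(complex \<Rightarrow> real) \<Rightarrow> (complex \<Rightarrow> real) \<Rightarrow> (complex \<Rightarrow> complex) \<Rightarrow> (complex \<Rightarrow> complex) \<Rightarrow> complex" where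
  "inner_00 \<rho> h s t = (LINT z|lborel. s z * cnj (t z) * of_real (h z) * of_real (\<rho> z))"

definition inner_01 ::
    "(complex \<Rightarrow> real) \<Rightarrow> (complex \<Rightarrow> complex) \<Rightarrow> (complex \<Rightarrow> complex) \<Rightarrow> complex" where
  "inner_01 h \<eta> \<xi> = (LINT z|lborel. \<eta> z * cnj (\<xi> z) * of_real (h z)) / of_real pi"

text \<open>
  Operators are given by their graphs: the first predicate says that \<open>v\<close> is the image of the
  \<open>(0,1)\<close>-form \<open>\<eta>\<close> under the formal adjoint of the Cauchy-Riemann operator \<open>d_zbar\<close>.
  Such a \<open>v\<close> is unique, because \<open>inner_00\<close> is positive definite on smooth sections.
\<close>

definition dbar_adjoint_rel ::
    "nat \<Rightarrow> (complex \<Rightarrow> real) \<Rightarrow> (complex \<Rightarrow> real) \<Rightarrow> (complex \<Rightarrow> complex) \<Rightarrow> (complex \<Rightarrow> complex) \<Rightarrow> bool" where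
  "dbar_adjoint_rel m \<rho> h \<eta> v \<longleftrightarrow>
     v \<in> A00 m \<and> (\<forall>t\<in>A00 m. inner_00 \<rho> h v t = inner_01 h \<eta> (d_zbar t))"

definition laplacian_rel ::
    "nat \<Rightarrow> (complex \<Rightarrow> real) \<Rightarrow> (complex \<Rightarrow> real) \<Rightarrow> (complex \<Rightarrow> complex) \<Rightarrow> (complex \<Rightarrow> complex) \<Rightarrow> bool" where
  "laplacian_rel m \<rho> h s v \<longleftrightarrow> s \<in> A00 m \<and> dbar_adjoint_rel m \<rho> h (d_zbar s) v"

definition invariant_eigenvalue ::
    "nat \<Rightarrow> (complex \<Rightarrow> real) \<Rightarrow> (complex \<Rightarrow> real) \<Rightarrow> real \<Rightarrow> bool" where
  "invariant_eigenvalue m \<rho> h l \<longleftrightarrow>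
     (\<exists>s. s \<noteq> (\<lambda>z. 0) \<and> S1_invariant s \<and> laplacian_rel m \<rho> h s (\<lambda>z. of_real l * s z))"

definition lambda_1 :: "nat \<Rightarrow> (complex \<Rightarrow> real) \<Rightarrow> (complex \<Rightarrow> real) \<Rightarrow> real" where
  "lambda_1 m \<rho> h = (LEAST l. l > 0 \<and> invariant_eigenvalue m \<rho> h l)"

end

theory Submission
  imports Defs
begin

text \<open>
  The volume form is the Fubini--Study form for every \<open>\<mu>\<close>, and the metric has a prescribed
  eigensection. With \<open>v = \<bar>z\<bar>\<^sup>2\<close>, an invariant section \<open>f (v)\<close> is an eigensection for \<open>\<lambda>\<close> iff
  \<open>(v h f')' = - \<lambda> h f / (1 + v)\<^sup>2\<close>. Taking for \<open>f\<close> the Moebius map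
  \<open>(K v - 1) / (N v + K)\<close> with \<open>N = m + 1\<close>, this equation is solved by an explicit \<open>h\<close>, smooth on
      \<open>O(m)\<close>,
  for \<open>\<lambda> = (K\<^sup>2 + N) / K\<close>. Because \<open>f\<close> is increasing with a single zero,
  substituting \<open>f g\<close> for a function that vanishes at this zero gives a Poincare inequality with
  constant \<open>\<lambda>\<close>; so \<open>\<lambda>\<close> is the first positive invariant eigenvalue, and it tends to infinity with
  \<open>K\<close>. The equation is linear in \<open>h\<close>, so \<open>h\<close> may be rescaled to make
  \<open>h (1)\<close> tend to infinity as well; \<open>z = 1\<close> is the point \<open>x = 1 / 2\<close>, where \<open>gbar = 1 / 2\<close>.
\<close>

section \<open>Smooth functions\<close>

text \<open>The metric is recovered from the eigenfunction f = \<open>f\<^sub>0\<close>. Put q = h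
  f'. The radial equation becomes (v q)' / (v q) = - lam f / (v f' (1 + v)^2), whose right side is
  rational, and partial fractions give 1/v - (N + 1)/(1 + v) - c/(1 + v)^2. The value lam = (K^2 +
  N)/K is exactly the one with residue 1 at v = 0, so that q, hence h, is smooth and positive at the
  origin. At infinity v q decays like v^(-N) and f' like v^(-2), so h decays like v^(1 - N); a
  metric on O(m) requires v^(-m), whence N = m + 1. The double pole at v = -1 produces the
  exponential factor and the constant \<open>c\<close>. Two points cost most of the work. The
  Laplacian is defined weakly, by testing against all smooth sections, so integration by parts takes
  place on the noncompact chart and needs decay estimates. And \<open>potential_metric\<close> is an
  arbitrary choice among metrics with the given curvature, so the symplectic coordinate has to be
  computed from the curvature equation and smoothness at the origin alone.\<close>

lemma Ck_SucI:
  assumes "\<And>x. (f has_derivative f' x) (at x)" "\<And>v. Ck k (\<lambda>x. f' x v)"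
  shows "Ck (Suc k) f"
  using assms by auto

lemma Ck_SucE:
  assumes "Ck (Suc k) f"
  obtains f' where "\<And>x. (f has_derivative f' x) (at x)" "\<And>v. Ck k (\<lambda>x. f' x v)"
  using assms unfolding Ck.simps by metis

lemma Ck_Suc_imp_Ck: "Ck (Suc k) f \<Longrightarrow> Ck k f"
proof (induction k arbitrary: f)
  case 0
  then show ?case
    by (auto simp: continuous_on_eq_continuous_at intro: has_derivative_continuous)
next
  case (Suc k)
  obtain f' where f': "\<And>x. (f has_derivative f' x) (at x)" "\<And>v. Ck (Suc k) (\<lambda>x. f' x v)"
    by (rule Ck_SucE[OF Suc.prems]) blast
  show ?case
    by (rule Ck_SucI[OF f'(1)]) (rule Suc.IH[OF f'(2)])
qed

lemma Ck_const: "Ck k (\<lambda>x. c)"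
  by (induction k arbitrary: c) (auto intro!: exI[of _ "\<lambda>_ _. 0"])

lemma Ck_linear:
  assumes "bounded_linear L"
  shows "Ck k L"
proof (cases k)
  case 0
  then show ?thesis
    using assms by (simp add: linear_continuous_on)
next
  case (Suc j)
  show ?thesis
    unfolding Suc
    by (rule Ck_SucI[OF bounded_linear_imp_has_derivative[OF assms]]) (rule Ck_const)
qed

lemma Ck_bounded_linear:
  assumes L: "bounded_linear L"
  shows "Ck k f \<Longrightarrow> Ck k (\<lambda>x. L (f x))"
proof (induction k arbitrary: f)
  case 0
  then show ?case
    using bounded_linear.continuous_on[OF L] by auto
next
  case (Suc k)
  obtain f' where f': "\<And>x. (f has_derivative f' x) (at x)" "\<And>v. Ck k (\<lambda>x. f' x v)"
    by (rule Ck_SucE[OF Suc.prems]) blast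
  show ?case
    by (rule Ck_SucI[OF bounded_linear.has_derivative[OF L f'(1)]]) (rule Suc.IH[OF f'(2)])
qed

lemma Ck_add: "Ck k f \<Longrightarrow> Ck k g \<Longrightarrow> Ck k (\<lambda>x. f x + g x)"
proof (induction k arbitrary: f g)
  case 0
  then show ?case
    by (auto intro: continuous_on_add)
next
  case (Suc k)
  obtain f' where f': "\<And>x. (f has_derivative f' x) (at x)" "\<And>v. Ck k (\<lambda>x. f' x v)"
    by (rule Ck_SucE[OF Suc.prems(1)]) blast
  obtain g' where g': "\<And>x. (g has_derivative g' x) (at x)" "\<And>v. Ck k (\<lambda>x. g' x v)"
    by (rule Ck_SucE[OF Suc.prems(2)]) blast
  show ?case
    by (rule Ck_SucI[OF has_derivative_add[OF f'(1) g'(1)]]) (rule Suc.IH[OF f'(2) g'(2)])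
qed

lemma Ck_mult:
  fixes f g :: "'a::real_normed_vector \<Rightarrow> 'b::real_normed_algebra"
  shows "Ck k f \<Longrightarrow> Ck k g \<Longrightarrow> Ck k (\<lambda>x. f x * g x)"
proof (induction k arbitrary: f g)
  case 0
  then show ?case
    by (auto intro: continuous_on_mult)
next
  case (Suc k)
  obtain f' where f': "\<And>x. (f has_derivative f' x) (at x)" "\<And>v. Ck k (\<lambda>x. f' x v)"
    by (rule Ck_SucE[OF Suc.prems(1)]) blast
  obtain g' where g': "\<And>x. (g has_derivative g' x) (at x)" "\<And>v. Ck k (\<lambda>x. g' x v)"
    by (rule Ck_SucE[OF Suc.prems(2)]) blast
  have fg: "Ck k f" "Ck k g"
    by (rule Ck_Suc_imp_Ck[OF Suc.prems(1)], rule Ck_Suc_imp_Ck[OF Suc.prems(2)])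
  show ?case
    by (rule Ck_SucI[OF has_derivative_mult[OF f'(1) g'(1)]])
      (intro Ck_add Suc.IH fg f'(2) g'(2))
qed

text \<open>The derivative of the inverse contains the inverse itself, one order lower, so the
  induction runs on \<open>k\<close> with \<open>f\<close> fixed.\<close>

lemma Ck_inverse:
  fixes f :: "'a::real_normed_vector \<Rightarrow> 'b::real_normed_div_algebra"
  assumes nz: "\<And>x. f x \<noteq> 0"
  shows "Ck k f \<Longrightarrow> Ck k (\<lambda>x. inverse (f x))"
proof (induction k)
  case 0
  then show ?case
    using nz by (auto intro: continuous_on_inverse)
next
  case (Suc k)
  obtain f' where f': "\<And>x. (f has_derivative f' x) (at x)" "\<And>v. Ck k (\<lambda>x. f' x v)"
    by (rule Ck_SucE[OF Suc.prems]) blast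
  have inv: "Ck k (\<lambda>x. inverse (f x))"
    by (rule Suc.IH[OF Ck_Suc_imp_Ck[OF Suc.prems]])
  have "((\<lambda>x. inverse (f x)) has_derivative
      (\<lambda>v. (- 1) * (inverse (f x) * f' x v * inverse (f x)))) (at x)" for x
    using Deriv.has_derivative_inverse[OF nz f'(1)] by simp
  then show ?case
    by (rule Ck_SucI) (intro Ck_mult Ck_const inv f'(2))
qed

lemma Ck_exp:
  fixes f :: "'a::real_normed_vector \<Rightarrow> real"
  shows "Ck k f \<Longrightarrow> Ck k (\<lambda>x. exp (f x))"
proof (induction k)
  case 0
  then show ?case
    by (auto intro: continuous_on_exp)
next
  case (Suc k)
  obtain f' where f': "\<And>x. (f has_derivative f' x) (at x)" "\<And>v. Ck k (\<lambda>x. f' x v)"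
    by (rule Ck_SucE[OF Suc.prems]) blast
  have e: "Ck k (\<lambda>x. exp (f x))"
    by (rule Suc.IH[OF Ck_Suc_imp_Ck[OF Suc.prems]])
  have "((\<lambda>x. exp (f x)) has_derivative (\<lambda>v. exp (f x) * f' x v)) (at x)" for x
    using f'(1)[of x] by (auto intro!: derivative_eq_intros)
  then show ?case
    by (rule Ck_SucI) (intro Ck_mult e f'(2))
qed

lemma Ck_ln:
  fixes f :: "'a::real_normed_vector \<Rightarrow> real"
  assumes pos: "\<And>x. f x > 0" and f: "Ck k f"
  shows "Ck k (\<lambda>x. ln (f x))"
proof (cases k)
  case 0
  have "continuous_on UNIV f"
    using f 0 by simp
  then show ?thesis
    using pos unfolding 0 by (auto intro!: continuous_on_ln simp: less_imp_neq[symmetric])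
next
  case (Suc j)
  obtain f' where f': "\<And>x. (f has_derivative f' x) (at x)" "\<And>v. Ck j (\<lambda>x. f' x v)"
    using f unfolding Suc by (rule Ck_SucE) blast
  have i: "Ck j (\<lambda>x. inverse (f x))"
    using Ck_inverse[OF _ Ck_Suc_imp_Ck[OF f[unfolded Suc]]] pos
    by (simp add: less_imp_neq[symmetric])
  have "((\<lambda>x. ln (f x)) has_derivative (\<lambda>v. inverse (f x) * f' x v)) (at x)" for x
    using f'(1)[of x] pos[of x] by (auto intro!: derivative_eq_intros simp: field_simps)
  then show ?thesis
    unfolding Suc by (rule Ck_SucI) (intro Ck_mult i f'(2))
qed

section \<open>Closure rules for smoothness, and derivatives of smooth functions\<close>

named_theorems smooth_intros

lemma smooth_const [smooth_intros]: "smooth (\<lambda>x. c)"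
  by (simp add: smooth_def Ck_const)

lemma smooth_linear: "bounded_linear L \<Longrightarrow> smooth L"
  by (simp add: smooth_def Ck_linear)

lemma smooth_of_real [smooth_intros]:
  "smooth f \<Longrightarrow> smooth (\<lambda>x. of_real (f x) :: 'b::{real_normed_algebra_1})"
  using Ck_bounded_linear[OF bounded_linear_of_real] by (auto simp: smooth_def)

lemma smooth_add [smooth_intros]: "smooth f \<Longrightarrow> smooth g \<Longrightarrow> smooth (\<lambda>x. f x + g x)"
  by (simp add: smooth_def Ck_add)

lemma smooth_mult [smooth_intros]:
  fixes f g :: "'a::euclidean_space \<Rightarrow> 'b::real_normed_algebra"
  shows "smooth f \<Longrightarrow> smooth g \<Longrightarrow> smooth (\<lambda>x. f x * g x)"
  by (simp add: smooth_def Ck_mult)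

lemma smooth_minus [smooth_intros]:
  fixes f :: "'a::euclidean_space \<Rightarrow> 'b::real_normed_algebra_1"
  assumes "smooth f"
  shows "smooth (\<lambda>x. - f x)"
  using smooth_mult[OF smooth_const[of "- 1"] assms] by simp

lemma smooth_diff [smooth_intros]:
  fixes f g :: "'a::euclidean_space \<Rightarrow> 'b::real_normed_algebra_1"
  assumes "smooth f" "smooth g"
  shows "smooth (\<lambda>x. f x - g x)"
  using smooth_add[OF assms(1) smooth_minus[OF assms(2)]] by simp

lemma smooth_power [smooth_intros]:
  fixes f :: "'a::euclidean_space \<Rightarrow> 'b::real_normed_algebra_1"
  shows "smooth f \<Longrightarrow> smooth (\<lambda>x. f x ^ n)"
  by (induction n) (auto intro: smooth_intros)

lemma smooth_divide [smooth_intros]: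
  fixes f g :: "'a::euclidean_space \<Rightarrow> 'b::real_normed_field"
  assumes "smooth f" "smooth g" "\<And>x. g x \<noteq> 0"
  shows "smooth (\<lambda>x. f x / g x)"
  using assms unfolding divide_inverse by (auto simp: smooth_def intro!: Ck_mult Ck_inverse)

lemma smooth_exp [smooth_intros]:
  fixes f :: "'a::euclidean_space \<Rightarrow> real"
  shows "smooth f \<Longrightarrow> smooth (\<lambda>x. exp (f x))"
  by (simp add: smooth_def Ck_exp)

lemma smooth_ln [smooth_intros]:
  fixes f :: "'a::euclidean_space \<Rightarrow> real"
  shows "smooth f \<Longrightarrow> (\<And>x. f x > 0) \<Longrightarrow> smooth (\<lambda>x. ln (f x))"
  by (simp add: smooth_def Ck_ln)

lemma smooth_ident [smooth_intros]: "smooth (\<lambda>x. x)"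
  by (rule smooth_linear[OF bounded_linear_ident])

lemma smooth_cmod_square [smooth_intros]: "smooth (\<lambda>z. cmod z ^ 2)"
  unfolding cmod_power2 by (intro smooth_intros smooth_linear bounded_linear_Re bounded_linear_Im)

lemma smooth_imp_continuous_on: "smooth f \<Longrightarrow> continuous_on A f"
  unfolding smooth_def by (metis Ck.simps(1) continuous_on_subset subset_UNIV)

lemma smooth_has_derivative:
  assumes "smooth f"
  shows "(f has_derivative frechet_derivative f (at x)) (at x)"
proof -
  have "Ck (Suc 0) f"
    using assms unfolding smooth_def by blast
  then show ?thesis
    using frechet_derivative_works by (auto simp: differentiable_def)
qed

text \<open>The derivative supplied by \<open>Ck\<close> may a priori depend on the order;
  uniqueness of derivatives identifies all of them with the Frechet derivative.\<close>

lemma smooth_frechet_derivative: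
  assumes "smooth f"
  shows "smooth (\<lambda>x. frechet_derivative f (at x) v)"
  unfolding smooth_def
proof
  fix k
  obtain f' where f': "\<And>x. (f has_derivative f' x) (at x)" "\<And>v. Ck k (\<lambda>x. f' x v)"
    using assms unfolding smooth_def by (metis Ck_SucE)
  have "frechet_derivative f (at x) = f' x" for x
    using frechet_derivative_at[OF f'(1)] by simp
  then show "Ck k (\<lambda>x. frechet_derivative f (at x) v)"
    using f'(2) by simp
qed

lemma smooth_d_zbar: "smooth f \<Longrightarrow> smooth (d_zbar f)"
  unfolding d_zbar_def[abs_def]
  by (intro smooth_intros smooth_frechet_derivative) auto

section \<open>Integrals over the plane\<close>

lemma emeasure_cmod_square_le:
  assumes "0 \<le> t"
  shows "emeasure lborel {z::complex. cmod z ^ 2 \<le> t} = ennreal (pi * t)"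
proof -
  have "{z::complex. cmod z ^ 2 \<le> t} = cball 0 (sqrt t)"
    using assms by (auto intro: real_le_rsqrt dest: sqrt_ge_absD[of "cmod _", simplified])
  moreover have "unit_ball_vol 2 = pi"
    using unit_ball_vol_even[of 1] by simp
  ultimately show ?thesis
    using assms by (simp add: emeasure_cball)
qed

text \<open>Polar coordinates at the level of measures: the disc where the square of the modulus is
  at most t has area pi t, and the half-lines \<open>{..t}\<close> generate the Borel sets. In the
  variable v, the squared modulus, no Jacobian is left but the constant pi.\<close>

lemma distr_cmod_square:
  "distr lborel borel (\<lambda>z::complex. cmod z ^ 2) =
      density lborel (\<lambda>v. ennreal (pi * indicat_real {0..} v))"
    (is "?M = ?N")
proof (rule measure_eqI_generator_eq_countable)
  let ?E = "range (\<lambda>a::real. {..a})"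
  have M: "emeasure ?M {..t} = ennreal (pi * max 0 t)" for t
  proof -
    have "emeasure ?M {..t} = emeasure lborel {z::complex. cmod z ^ 2 \<le> t}"
      by (subst emeasure_distr) (auto simp: vimage_def)
    also have "\<dots> = ennreal (pi * max 0 t)"
    proof (cases "0 \<le> t")
      case True
      then show ?thesis by (simp add: emeasure_cmod_square_le)
    next
      case False
      then have "{z::complex. cmod z ^ 2 \<le> t} = {}"
        by (smt (verit) Collect_empty_eq zero_le_power2)
      then show ?thesis using False by simp
    qed
    finally show ?thesis .
  qed
  have N: "emeasure ?N {..t} = ennreal (pi * max 0 t)" for t
  proof -
    have "emeasure ?N {..t} = (\<integral>\<^sup>+ v. ennreal pi * indicator {0..t} v \<partial>lborel)"
      by (subst emeasure_density) (auto intro!: nn_integral_cong simp: indicator_def)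
    also have "\<dots> = ennreal (pi * max 0 t)"
      by (cases "0 \<le> t") (auto simp: nn_integral_cmult ennreal_mult)
    finally show ?thesis .
  qed
  show "Int_stable ?E"
    by (auto simp: Int_stable_def Int_atMost intro: rangeI)
  show "?E \<subseteq> Pow UNIV" by simp
  show "emeasure ?M X = emeasure ?N X" if "X \<in> ?E" for X
    using that M N by auto
  show "sets ?M = sigma_sets UNIV ?E" "sets ?N = sigma_sets UNIV ?E"
    by (simp_all add: borel_eq_atMost sets_measure_of)
  show "(\<lambda>n::nat. {..real n}) ` UNIV \<subseteq> ?E" by auto
  show "\<Union> ((\<lambda>n::nat. {..real n}) ` UNIV) = UNIV"
    using real_arch_simple by auto
  show "emeasure ?M a \<noteq> \<infinity>" if "a \<in> (\<lambda>n::nat. {..real n}) ` UNIV" for a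
    using that M by auto
qed auto

lemma integrable_radial_iff:
  fixes F :: "real \<Rightarrow> real"
  assumes [measurable]: "F \<in> borel_measurable borel"
  shows "integrable lborel (\<lambda>z::complex. F (cmod z ^ 2)) \<longleftrightarrow> set_integrable lborel {0..} F"
proof -
  have "integrable lborel (\<lambda>z::complex. F (cmod z ^ 2)) \<longleftrightarrow>
      integrable (distr lborel borel (\<lambda>z::complex. cmod z ^ 2)) F"
    by (rule integrable_distr_eq[symmetric]) auto
  also have "\<dots> \<longleftrightarrow> integrable lborel (\<lambda>v. (pi * indicat_real {0..} v) *\<^sub>R F v)"
    unfolding distr_cmod_square by (rule integrable_density) auto
  also have "\<dots> \<longleftrightarrow> integrable lborel (\<lambda>v. pi * (indicat_real {0..} v *\<^sub>R F v))"
    by (simp add: mult.assoc)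
  finally show ?thesis
    by (simp add: set_integrable_def)
qed

lemma integral_radial:
  fixes F :: "real \<Rightarrow> real"
  assumes [measurable]: "F \<in> borel_measurable borel"
  shows "(LINT z|lborel. F (cmod (z::complex) ^ 2)) = pi * (LINT v:{0..}|lborel. F v)"
proof -
  have "(LINT z|lborel. F (cmod (z::complex) ^ 2)) =
      (LINT v|distr lborel borel (\<lambda>z::complex. cmod z ^ 2). F v)"
    by (rule integral_distr[symmetric]) auto
  also have "\<dots> = (LINT v|lborel. (pi * indicat_real {0..} v) *\<^sub>R F v)"
    unfolding distr_cmod_square by (rule integral_density) auto
  also have "\<dots> = (LINT v|lborel. pi * (indicat_real {0..} v *\<^sub>R F v))"
    by (simp add: mult.assoc)
  finally show ?thesis
    by (simp add: set_lebesgue_integral_def)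
qed

text \<open>Nonnegativity acts twice: it gives integrability from the mere existence of the limit,
  and it makes \<open>F\<close> increasing, so that \<open>L - F a\<close> is nonnegative and
  survives the passage through extended nonnegative reals.\<close>

lemma integral_FTC_atLeast:
  fixes f F :: "real \<Rightarrow> real"
  assumes "\<And>x. a \<le> x \<Longrightarrow> (F has_real_derivative f x) (at x)"
    and "\<And>x. a \<le> x \<Longrightarrow> 0 \<le> f x" and [measurable]: "f \<in> borel_measurable borel"
    and "(F \<longlongrightarrow> L) at_top"
  shows "set_integrable lborel {a..} f" "(LINT x:{a..}|lborel. f x) = L - F a"
proof -
  have "has_bochner_integral lborel (\<lambda>x. indicator {a..} x *\<^sub>R f x) (L - F a)"
  proof (rule has_bochner_integral_nn_integral)
    have "(\<integral>\<^sup>+ x. ennreal (f x) * indicator {a..} x \<partial>lborel) = ennreal (L - F a)"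
      by (rule nn_integral_FTC_atLeast) (use assms in auto)
    then show "(\<integral>\<^sup>+ x. ennreal (indicator {a..} x *\<^sub>R f x) \<partial>lborel) = ennreal (L - F a)"
      by (subst nn_integral_cong[where v="\<lambda>x. ennreal (f x) * indicator {a..} x"])
        (auto simp: indicator_def)
    have "F a \<le> F x" if "a \<le> x" for x
      by (rule DERIV_nonneg_imp_nondecreasing[OF that]) (use assms(1,2) in blast)
    then have "eventually (\<lambda>x. F a \<le> F x) at_top"
      by (rule eventually_mono[OF eventually_ge_at_top[of a]])
    then show "0 \<le> L - F a"
      using tendsto_lowerbound[OF assms(4)] by simp
  qed (use assms(2) in \<open>auto simp: indicator_def\<close>)
  then show "set_integrable lborel {a..} f" "(LINT x:{a..}|lborel. f x) = L - F a"
    by (auto simp: set_integrable_def set_lebesgue_integral_def has_bochner_integral_iff)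
qed

section \<open>Cubic decay, and integrals of directional derivatives\<close>

lemma integrable_cubic_decay: "integrable lborel (\<lambda>z::complex. 1 / (1 + cmod z) ^ 3)"
proof (rule Bochner_Integration.integrable_bound)
  \<comment> \<open>(1 + v)^(-3/2) with v = r^2 dominates (1 + r)^(-3), because sqrt (1 + r^2) \<le>
    1 + r, and it has the explicit antiderivative -2 / sqrt (1 + v).\<close>
  let ?f = "\<lambda>v::real. 1 / ((1 + v) * sqrt (1 + v))"
  have "((\<lambda>v. - 2 / sqrt (1 + v)) has_real_derivative ?f v) (at v)" if "0 \<le> v" for v
    using that by (auto intro!: derivative_eq_intros simp: field_simps)
  moreover have "((\<lambda>v. - 2 / sqrt (1 + v)) \<longlongrightarrow> (0::real)) at_top"
    by real_asymp
  ultimately have "set_integrable lborel {0..} ?f"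
    by (intro integral_FTC_atLeast(1)[where F="\<lambda>v. - 2 / sqrt (1 + v)"]) auto
  then show "integrable lborel (\<lambda>z::complex. ?f (cmod z ^ 2))"
    by (subst integrable_radial_iff) auto
  show "AE z::complex in lborel. norm (1 / (1 + cmod z) ^ 3) \<le> norm (?f (cmod z ^ 2))"
  proof (rule AE_I2)
    fix z :: complex
    have le: "sqrt (1 + cmod z ^ 2) \<le> 1 + cmod z"
      by (rule real_le_lsqrt) (auto simp: power2_eq_square algebra_simps)
    have pos: "0 < 1 + cmod z ^ 2"
      by (smt (verit) zero_le_power2)
    have "(1 + cmod z ^ 2) * sqrt (1 + cmod z ^ 2) = sqrt (1 + cmod z ^ 2) ^ 3"
      using pos by (simp add: power3_eq_cube)
    also have "\<dots> \<le> (1 + cmod z) ^ 3"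
      using pos by (intro power_mono le) auto
    finally have *: "(1 + cmod z ^ 2) * sqrt (1 + cmod z ^ 2) \<le> (1 + cmod z) ^ 3" .
    have "1 / (1 + cmod z) ^ 3 \<le> ?f (cmod z ^ 2)"
      by (rule divide_left_mono[OF *]) (use pos in \<open>auto intro!: mult_pos_pos simp: add_pos_nonneg\<close>)
    then show "norm (1 / (1 + cmod z) ^ 3) \<le> norm (?f (cmod z ^ 2))"
      using pos by simp
  qed
qed auto

lemma integrable_of_cubic_decay:
  fixes f :: "complex \<Rightarrow> 'b::{banach, second_countable_topology}"
  assumes "continuous_on UNIV f" "\<And>z. norm (f z) \<le> C / (1 + cmod z) ^ 3"
  shows "integrable lborel f"
proof (rule Bochner_Integration.integrable_bound)
  show "integrable lborel (\<lambda>z::complex. C * (1 / (1 + cmod z) ^ 3))"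
    by (intro integrable_mult_right integrable_cubic_decay)
  show "f \<in> borel_measurable lborel"
    using borel_measurable_continuous_onI[OF assms(1)] by simp
  show "AE z in lborel. norm (f z) \<le> norm (C * (1 / (1 + cmod z) ^ 3))"
    by (rule AE_I2, rule order_trans[OF assms(2)]) (auto intro!: divide_right_mono)
qed

text \<open>A shift of length at most 1 changes 1 + |z| by a factor of at most 2, hence the cube by
  at most 8. This gives one integrable bound for all difference quotients with step at most
  1.\<close>

lemma cubic_decay_translate:
  assumes "norm a \<le> 1" "0 \<le> C"
  shows "C / (1 + cmod (z + a)) ^ 3 \<le> 8 * C / (1 + cmod z) ^ 3"
proof -
  have "cmod z \<le> cmod (z + a) + cmod a"
    using norm_triangle_ineq4[of "z + a" a] by simp
  then have "1 + cmod z \<le> 2 * (1 + cmod (z + a))"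
    using assms(1) norm_ge_zero[of "z + a"] by (smt (verit))
  then have "(1 + cmod z) ^ 3 \<le> (2 * (1 + cmod (z + a))) ^ 3"
    by (rule power_mono) auto
  also have "\<dots> = 8 * (1 + cmod (z + a)) ^ 3"
    unfolding power_mult_distrib by simp
  finally have "8 * C / (8 * (1 + cmod (z + a)) ^ 3) \<le> 8 * C / (1 + cmod z) ^ 3"
    using assms(2) by (intro divide_left_mono) (auto intro!: mult_pos_pos simp: add_pos_nonneg)
  then show ?thesis
    by simp
qed

text \<open>The integral of the difference quotients vanishes by translation invariance.\<close>

lemma integral_directional_derivative:
  fixes X :: "complex \<Rightarrow> complex"
  assumes X': "\<And>z. (X has_derivative X' z) (at z)"
    and cont: "continuous_on UNIV (\<lambda>z. X' z w)" and w: "norm w = 1"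
    and bX: "\<And>z. norm (X z) \<le> C / (1 + cmod z) ^ 3"
    and bX': "\<And>z. norm (X' z w) \<le> C / (1 + cmod z) ^ 3"
  shows "(LINT z|lborel. X' z w) = 0"
proof -
  have C: "0 \<le> C"
    using order_trans[OF norm_ge_zero bX[of 0]] by simp
  have contX: "continuous_on UNIV X"
    using X' by (auto simp: continuous_on_eq_continuous_at intro: has_derivative_continuous)
  have intX: "integrable lborel X"
    by (rule integrable_of_cubic_decay[OF contX bX])
  define D where "D n z = of_nat (Suc n) * (X (z + w / of_nat (Suc n)) - X z)" for n z
  have contD: "continuous_on UNIV (D n)" for n
    unfolding D_def by (intro continuous_intros continuous_on_compose2[OF contX]) auto
  have int0: "(LINT z|lborel. D n z) = 0" for n
  proof -
    let ?a = "w / of_nat (Suc n)"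
    have "integrable lborel (\<lambda>z. X (?a + z))"
      using intX lborel_distr_plus[of ?a] integrable_distr_eq[of "(+) ?a" lborel borel X]
        borel_measurable_continuous_onI[OF contX] by simp
    moreover have "(LINT z|lborel. X (?a + z)) = (LINT z|lborel. X z)"
      using lborel_distr_plus[of ?a] integral_distr[of "(+) ?a" lborel borel X]
        borel_measurable_continuous_onI[OF contX] by simp
    ultimately show ?thesis
      unfolding D_def using intX by (simp add: add.commute)
  qed
  have "(\<lambda>n. LINT z|lborel. D n z) \<longlonglongrightarrow> (LINT z|lborel. X' z w)"
  proof (rule integral_dominated_convergence)
    show "integrable lborel (\<lambda>z::complex. 8 * C * (1 / (1 + cmod z) ^ 3))"
      by (intro integrable_mult_right integrable_cubic_decay)
    show "(\<lambda>z. X' z w) \<in> borel_measurable lborel" "D n \<in> borel_measurable lborel" for n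
      using borel_measurable_continuous_onI[OF cont] borel_measurable_continuous_onI[OF contD]
      by simp_all
    show "AE z in lborel. (\<lambda>n. D n z) \<longlonglongrightarrow> X' z w"
    proof (rule AE_I2)
      fix z
      interpret L: bounded_linear "X' z"
        using X' by (rule has_derivative_bounded_linear)
      let ?h = "\<lambda>n. w /\<^sub>R real (Suc n)"
      have "?h \<longlonglongrightarrow> 0"
        using tendsto_scaleR[OF LIMSEQ_inverse_real_of_nat tendsto_const[of w]] by simp
      moreover have "w \<noteq> 0"
        using w by auto
      ultimately have "filterlim ?h (at 0) sequentially"
        by (simp add: filterlim_at)
      then have "(\<lambda>n. norm (X (z + ?h n) - X z - X' z (?h n)) / norm (?h n)) \<longlonglongrightarrow> 0"
        using filterlim_compose[OF conjunct2[OF X'[of z, unfolded has_derivative_at]]] by blast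
      also have "(\<lambda>n. norm (X (z + ?h n) - X z - X' z (?h n)) / norm (?h n)) =
          (\<lambda>n. norm (D n z - X' z w))"
      proof
        fix n
        have *: "D n z - X' z w = real (Suc n) *\<^sub>R (X (z + ?h n) - X z - X' z (?h n))"
          unfolding D_def L.scaleR by (simp add: scaleR_conv_of_real field_simps del: of_nat_Suc)
        have "norm (?h n) = inverse (real (Suc n))"
          using w by simp
        then show "norm (X (z + ?h n) - X z - X' z (?h n)) / norm (?h n) = norm (D n z - X' z w)"
          unfolding * norm_scaleR by (simp del: of_nat_Suc add: divide_inverse)
      qed
      finally show "(\<lambda>n. D n z) \<longlonglongrightarrow> X' z w"
        by (simp add: LIM_zero_cancel tendsto_norm_zero_iff)
    qed
    show "AE z in lborel. norm (D n z) \<le> 8 * C * (1 / (1 + cmod z) ^ 3)" for n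
    proof (rule AE_I2)
      fix z
      \<comment> \<open>Mean value inequality on the segment from z to z + w/(n + 1): the quotient
        is bounded by the derivative at a point within distance 1 of z, so the dominating function
        is the same for every n.\<close>
      have "((\<lambda>s. X (z + s *\<^sub>R w)) has_derivative (\<lambda>h. X' (z + s *\<^sub>R w) (h *\<^sub>R w))) (at s)"
          for s :: real
        by (rule has_derivative_compose[where f="\<lambda>s. z + s *\<^sub>R w" and f'="\<lambda>h. h *\<^sub>R w", OF _ X'])
          (auto intro!: derivative_eq_intros)
      moreover have "continuous_on {0..1 / real (Suc n)} (\<lambda>s. X (z + s *\<^sub>R w))"
        by (intro continuous_intros continuous_on_compose2[OF contX]) auto
      ultimately obtain s where s: "0 < s" "s < 1 / real (Suc n)"
        and le: "norm (X (z + (1 / real (Suc n)) *\<^sub>R w) - X (z + 0 *\<^sub>R w)) \<le>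
          norm (X' (z + s *\<^sub>R w) ((1 / real (Suc n) - 0) *\<^sub>R w))"
        using mvt_general[of 0 "1 / real (Suc n)" "\<lambda>s. X (z + s *\<^sub>R w)"
            "\<lambda>s h. X' (z + s *\<^sub>R w) (h *\<^sub>R w)"] by auto
      have "norm (D n z) = real (Suc n) * norm (X (z + (1 / real (Suc n)) *\<^sub>R w) - X z)"
        unfolding D_def norm_mult norm_of_nat by (simp add: scaleR_conv_of_real)
      also have "\<dots> \<le> real (Suc n) * norm (X' (z + s *\<^sub>R w) ((1 / real (Suc n)) *\<^sub>R w))"
        using le by (intro mult_left_mono) auto
      also have "\<dots> = norm (X' (z + s *\<^sub>R w) w)"
        by (simp add: linear_cmul[OF has_derivative_linear[OF X']] del: of_nat_Suc)
      also have "\<dots> \<le> C / (1 + cmod (z + s *\<^sub>R w)) ^ 3"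
        by (rule bX')
      also have "\<dots> \<le> 8 * C / (1 + cmod z) ^ 3"
      proof (rule cubic_decay_translate[OF _ C])
        have "s \<le> 1"
          using s(2) by (rule order.trans[OF less_imp_le]) simp
        then show "norm (s *\<^sub>R w) \<le> 1"
          using s(1) w by simp
      qed
      finally show "norm (D n z) \<le> 8 * C * (1 / (1 + cmod z) ^ 3)"
        by simp
    qed
  qed
  then show ?thesis
    by (simp add: int0 LIMSEQ_const_iff)
qed

section \<open>Growth of sections\<close>

lemma frechet_derivative_complex:
  fixes f :: "complex \<Rightarrow> complex"
  assumes "(f has_derivative D) (at z)"
  shows "D u = of_real (Re u) * D 1 + of_real (Im u) * D \<i>"
proof -
  interpret bounded_linear D
    using assms by (rule has_derivative_bounded_linear)
  have "D u = D (Re u *\<^sub>R 1 + Im u *\<^sub>R \<i>)"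
    by (rule arg_cong[of _ _ D]) (simp add: complex_eq_iff)
  then show ?thesis
    unfolding add scaleR by (simp add: scaleR_conv_of_real)
qed

lemma smooth_bounded_on_disc:
  fixes f :: "complex \<Rightarrow> complex"
  assumes "smooth f"
  obtains B where "0 \<le> B" "\<And>z. cmod z \<le> 1 \<Longrightarrow> norm (f z) \<le> B"
proof -
  have "bounded (f ` cball 0 1)"
    by (intro compact_imp_bounded compact_continuous_image smooth_imp_continuous_on[OF assms]) auto
  then obtain B where "B > 0" "\<And>x. x \<in> f ` cball 0 1 \<Longrightarrow> norm x \<le> B"
    unfolding bounded_pos by blast
  then show ?thesis
    by (intro that[of B]) auto
qed

text \<open>Compactness of the projective line in two charts: inside the unit disc \<open>t\<close>
  and its derivative are bounded by continuity, outside \<open>t z = z ^ m * g (1 / z)\<close> with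
  \<open>g\<close> smooth, hence bounded with its derivative on the unit disc.\<close>

lemma A00_growth:
  assumes t: "t \<in> A00 m" and w: "norm w = 1"
  obtains T where "\<And>z. norm (t z) \<le> T * (1 + cmod z) ^ m"
    "\<And>z. norm (frechet_derivative t (at z) w) \<le> T * (1 + cmod z) ^ m"
proof -
  obtain g where smt: "smooth t" and smg: "smooth g" and g: "\<And>w. w \<noteq> 0 \<Longrightarrow> g w = w ^ m * t (1 / w)"
    using t unfolding A00_def by blast
  define Dg where "Dg z = frechet_derivative g (at z)" for z
  have Dg: "(g has_derivative Dg z) (at z)" for z
    unfolding Dg_def by (rule smooth_has_derivative[OF smg])
  obtain B1 where B1: "0 \<le> B1" "\<And>z. cmod z \<le> 1 \<Longrightarrow> norm (t z) \<le> B1"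
    by (rule smooth_bounded_on_disc[OF smt]) blast
  obtain B2 where B2: "0 \<le> B2" "\<And>z. cmod z \<le> 1 \<Longrightarrow> norm (frechet_derivative t (at z) w) \<le> B2"
    by (rule smooth_bounded_on_disc[OF smooth_frechet_derivative[OF smt]]) blast
  obtain B3 where B3: "0 \<le> B3" "\<And>z. cmod z \<le> 1 \<Longrightarrow> norm (g z) \<le> B3"
    by (rule smooth_bounded_on_disc[OF smg]) blast
  obtain B4 where B4: "0 \<le> B4" "\<And>z. cmod z \<le> 1 \<Longrightarrow> norm (Dg z 1) \<le> B4"
    unfolding Dg_def by (rule smooth_bounded_on_disc[OF smooth_frechet_derivative[OF smg]]) blast
  obtain B5 where B5: "0 \<le> B5" "\<And>z. cmod z \<le> 1 \<Longrightarrow> norm (Dg z \<i>) \<le> B5"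
    unfolding Dg_def by (rule smooth_bounded_on_disc[OF smooth_frechet_derivative[OF smg]]) blast
  have Dg_le: "norm (Dg z u) \<le> norm u * (B4 + B5)" if "cmod z \<le> 1" for z u
  proof -
    have "norm (Dg z u) \<le> \<bar>Re u\<bar> * norm (Dg z 1) + \<bar>Im u\<bar> * norm (Dg z \<i>)"
      unfolding frechet_derivative_complex[OF Dg, of z u]
      by (rule order_trans[OF norm_triangle_ineq]) (simp add: norm_mult)
    also have "\<dots> \<le> norm u * B4 + norm u * B5"
      by (intro add_mono mult_mono abs_Re_le_cmod abs_Im_le_cmod B4 B5 that) auto
    finally show ?thesis
      by (simp add: distrib_left)
  qed
  define T where "T = B1 + B2 + (real m + 1) * B3 + B4 + B5"
  have mB3: "0 \<le> real m * B3"
    using B3 by simp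
  have T: "B1 \<le> T" "B2 \<le> T" "B3 \<le> T" "real m * B3 + (B4 + B5) \<le> T" "0 \<le> T"
    unfolding T_def distrib_right using B1(1) B2(1) B3(1) B4(1) B5(1) mB3 by auto
  have t_eq: "t z = z ^ m * g (1 / z)" if "z \<noteq> 0" for z
    using g[of "1 / z"] that by (simp add: field_simps)
  have "norm (t z) \<le> T * (1 + cmod z) ^ m" for z
  proof (cases "cmod z \<le> 1")
    case True
    then show ?thesis
      using mult_mono[OF order_trans[OF B1(2)[OF True] T(1)] one_le_power[of "1 + cmod z" m]] T
      by simp
  next
    case False
    then have "norm (t z) = norm (g (1 / z)) * cmod z ^ m"
      by (subst t_eq) (auto simp: norm_mult norm_power)
    also have "\<dots> \<le> T * (1 + cmod z) ^ m"
      using False by (intro mult_mono power_mono order_trans[OF B3(2) T(3)] T)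
        (auto simp: norm_divide divide_le_eq_1)
    finally show ?thesis .
  qed
  moreover have "norm (frechet_derivative t (at z) w) \<le> T * (1 + cmod z) ^ m" for z
  proof (cases "cmod z \<le> 1")
    case True
    then show ?thesis
      using mult_mono[OF order_trans[OF B2(2)[OF True] T(2)] one_le_power[of "1 + cmod z" m]] T
      by simp
  next
    case False
    then have nz: "z \<noteq> 0" by auto
    have le1: "cmod (1 / z) \<le> 1"
      using False by (auto simp: norm_divide divide_le_eq_1)
    \<comment> \<open>For m = 0 the exponent \<open>m - 1\<close> is truncated to 0, but the factor
      \<open>of_nat m\<close> then removes the term.\<close>
    have "((\<lambda>z. z ^ m * g (1 / z)) has_derivative
        (\<lambda>u. z ^ m * Dg (1 / z) (- u / z ^ 2) + of_nat m * u * z ^ (m - 1) * g (1 / z))) (at z)"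
      by (rule has_derivative_mult[where f="\<lambda>z. z ^ m" and f'="\<lambda>u. of_nat m * u * z ^ (m - 1)"])
        (use nz in \<open>auto intro!: derivative_eq_intros has_derivative_compose[where g=g, OF _ Dg]
            simp: power2_eq_square\<close>)
    then have "(t has_derivative
        (\<lambda>u. z ^ m * Dg (1 / z) (- u / z ^ 2) + of_nat m * u * z ^ (m - 1) * g (1 / z))) (at z)"
      by (rule has_derivative_transform_within_open[of _ _ _ _ "- {0}"]) (use nz t_eq in auto)
    then have "frechet_derivative t (at z) w =
        z ^ m * Dg (1 / z) (- w / z ^ 2) + of_nat m * w * z ^ (m - 1) * g (1 / z)"
      by (simp add: frechet_derivative_at[symmetric])
    also have "norm \<dots> \<le> cmod z ^ m * norm (Dg (1 / z) (- w / z ^ 2))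
        + real m * cmod z ^ (m - 1) * norm (g (1 / z))"
      using w by (intro order_trans[OF norm_triangle_ineq]) (simp add: norm_mult norm_power)
    also have "\<dots> \<le> (1 + cmod z) ^ m * (B4 + B5) + real m * (1 + cmod z) ^ m * B3"
    proof (intro add_mono mult_mono)
      have "norm (- w / z ^ 2) \<le> 1"
        using False w by (auto simp: norm_divide norm_power divide_le_eq_1 power_le_one_iff)
      then show "norm (Dg (1 / z) (- w / z ^ 2)) \<le> B4 + B5"
        using order_trans[OF Dg_le[OF le1] mult_right_mono[of _ 1 "B4 + B5"]] B4 B5 by simp
      show "cmod z ^ (m - 1) \<le> (1 + cmod z) ^ m"
        by (rule order_trans[OF power_mono power_increasing]) auto
    qed (use B3 le1 in \<open>auto intro!: power_mono\<close>)
    also have "\<dots> = (real m * B3 + (B4 + B5)) * (1 + cmod z) ^ m"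
      by (simp add: algebra_simps)
    also have "\<dots> \<le> T * (1 + cmod z) ^ m"
      by (intro mult_right_mono T) auto
    finally show ?thesis .
  qed
  ultimately show ?thesis
    by (rule that)
qed

section \<open>A metric with an explicit eigenfunction\<close>

lemma one_plus_cmod_square: "1 + (cmod z)\<^sup>2 > 0" "1 + (cmod z)\<^sup>2 \<noteq> 0"
proof -
  show "1 + (cmod z)\<^sup>2 > 0"
    by (intro add_pos_nonneg) auto
  then show "1 + (cmod z)\<^sup>2 \<noteq> 0"
    by linarith
qed

text \<open>The bound on \<open>K\<close> says N \<le> K, hence c \<ge> 0, from which the decay
  estimates follow. \<open>A\<close> is a free scale: the metric is linear in it, while the
  eigenvalue \<open>lam\<close> does not contain it.\<close>

locale test_metric =
  fixes m :: nat and K A :: real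
  assumes K: "real m + 1 \<le> K" and A: "0 < A"
begin

definition "N = real m + 1"
definition "c = (K - N) * (K + 1) / K"
text \<open>This is exp (c / (1 + v)), the contribution of the double pole at v = -1, normalised to
  be 1 at v = 0. For c \<ge> 0 it is at most 1 on the half-line, and in y = 1/v it reads exp (- c /
  (1 + y)), smooth across y = 0.\<close>

definition E :: "real \<Rightarrow> real" where "E v = exp (- c * v / (1 + v))"
definition h\<^sub>0 :: "real \<Rightarrow> real" where "h\<^sub>0 v = A * (N * v + K)\<^sup>2 * E v / (1 + v) ^ (m + 2)"
definition f\<^sub>0 :: "real \<Rightarrow> real" where "f\<^sub>0 v = (K * v - 1) / (N * v + K)"
definition f\<^sub>1 :: "real \<Rightarrow> real" where "f\<^sub>1 v = (K\<^sup>2 + N) / (N * v + K)\<^sup>2"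
text \<open>The product of metric and derivative of the eigenfunction, in which the factor (N v +
  K)^2 has cancelled; v times it is the flux of the radial equation. \<open>q\<^sub>1\<close> is its
  derivative.\<close>

definition q\<^sub>0 :: "real \<Rightarrow> real" where "q\<^sub>0 v = A * (K\<^sup>2 + N) * E v / (1 + v) ^ (m + 2)"
definition q\<^sub>1 :: "real \<Rightarrow> real" where
  "q\<^sub>1 v = - A * (K\<^sup>2 + N) * E v * (c + (N + 1) * (1 + v)) / (1 + v) ^ (m + 4)"
definition "lam = (K\<^sup>2 + N) / K"

definition h :: "complex \<Rightarrow> real" where "h z = h\<^sub>0 ((cmod z)\<^sup>2)"
definition f :: "complex \<Rightarrow> complex" where "f z = of_real (f\<^sub>0 ((cmod z)\<^sup>2))"

lemma pos: "N > 0" "K > 0" "c \<ge> 0" "N \<le> K" "lam > 0"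
proof -
  show "N > 0" "K > 0" "N \<le> K"
    using K by (auto simp: N_def)
  then show "c \<ge> 0" "lam > 0"
    unfolding c_def lam_def by (auto intro!: divide_nonneg_pos divide_pos_pos add_pos_pos)
qed

lemma denom_pos: "0 \<le> v \<Longrightarrow> N * v + K > 0"
  using pos by (intro add_nonneg_pos) auto

lemma E_pos: "E v > 0"
  by (simp add: E_def)

lemma E_le_1: "0 \<le> v \<Longrightarrow> E v \<le> 1"
  using pos by (simp add: E_def)

lemma h\<^sub>0_pos: "0 \<le> v \<Longrightarrow> h\<^sub>0 v > 0"
  unfolding h\<^sub>0_def using A E_pos denom_pos by (intro divide_pos_pos mult_pos_pos) (auto simp:
      less_imp_neq[symmetric])

lemma q\<^sub>0_nonneg: "0 \<le> v \<Longrightarrow> q\<^sub>0 v \<ge> 0"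
  unfolding q\<^sub>0_def using A E_pos pos by (auto intro!: divide_nonneg_pos mult_nonneg_nonneg
      less_imp_le[OF E_pos])

lemma h\<^sub>0_times_f\<^sub>1: "0 \<le> v \<Longrightarrow> h\<^sub>0 v * f\<^sub>1 v = q\<^sub>0 v"
  unfolding h\<^sub>0_def f\<^sub>1_def q\<^sub>0_def using denom_pos[of v] by simp

lemma f\<^sub>0_deriv: "0 \<le> v \<Longrightarrow> (f\<^sub>0 has_real_derivative f\<^sub>1 v) (at v)"
  unfolding f\<^sub>0_def[abs_def] f\<^sub>1_def using denom_pos[of v]
  by (auto intro!: derivative_eq_intros simp: power2_eq_square field_simps)

lemma E_deriv: "0 \<le> v \<Longrightarrow> (E has_real_derivative - c * E v / (1 + v)\<^sup>2) (at v)"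
  unfolding E_def[abs_def]
  by (auto intro!: derivative_eq_intros simp: power2_eq_square field_simps)

lemma q\<^sub>0_deriv:
  assumes "0 \<le> v"
  shows "(q\<^sub>0 has_real_derivative q\<^sub>1 v) (at v)"
proof -
  have nz: "1 + v \<noteq> 0" using assms by simp
  have p: "((\<lambda>v. (1 + v) ^ (m + 2)) has_real_derivative (N + 1) * (1 + v) ^ (m + 1)) (at v)"
    by (auto intro!: derivative_eq_intros simp: N_def simp del: power_Suc)
  have "((\<lambda>v. A * (K\<^sup>2 + N) * E v / (1 + v) ^ (m + 2)) has_real_derivative
    (A * (K\<^sup>2 + N) * (- c * E v / (1 + v)\<^sup>2) * (1 + v) ^ (m + 2)
      - A * (K\<^sup>2 + N) * E v * ((N + 1) * (1 + v) ^ (m + 1)))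
    / ((1 + v) ^ (m + 2) * (1 + v) ^ (m + 2))) (at v)"
    by (intro DERIV_divide DERIV_cmult E_deriv assms p) (use nz in auto)
  also have "(A * (K\<^sup>2 + N) * (- c * E v / (1 + v)\<^sup>2) * (1 + v) ^ (m + 2)
      - A * (K\<^sup>2 + N) * E v * ((N + 1) * (1 + v) ^ (m + 1)))
    / ((1 + v) ^ (m + 2) * (1 + v) ^ (m + 2)) = q\<^sub>1 v"
    unfolding q\<^sub>1_def using nz by (simp add: power_add divide_simps) (simp add: algebra_simps
        power2_eq_square power4_eq_xxxx)
  finally show ?thesis
    unfolding q\<^sub>0_def[abs_def] .
qed

text \<open>The radial form of the eigenvalue equation: \<open>(v h f')' = - \<lambda> h f / (1 + v)\<^sup>2\<close>.\<close>

lemma flux_deriv: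
  assumes "0 \<le> v"
  shows "q\<^sub>0 v + v * q\<^sub>1 v = - lam * h\<^sub>0 v * f\<^sub>0 v / (1 + v)\<^sup>2"
proof -
  have nz: "1 + v \<noteq> 0" and pd: "N * v + K \<noteq> 0" using assms denom_pos[of v] by auto
  have Kc: "K * c = (K - N) * (K + 1)"
    using pos by (simp add: c_def)
  \<comment> \<open>Up to the positive factor \<open>q\<^sub>0 v / (1 + v)\<^sup>2\<close>, the
    derivative of the flux is this quadratic in v. The constant \<open>c\<close> is what places its
    roots at 1/K and -K/N, the zero and the pole of \<open>f\<^sub>0\<close>.\<close>
  have "K * ((1 + v)\<^sup>2 - v * (c + (N + 1) * (1 + v))) =
      K * (1 + v)\<^sup>2 - v * (K * c + K * (N + 1) * (1 + v))"
    by (simp add: algebra_simps)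
  also have "\<dots> = - ((N * v + K) * (K * v - 1))"
    unfolding Kc by (simp add: algebra_simps power2_eq_square)
  finally have key: "(1 + v)\<^sup>2 - v * (c + (N + 1) * (1 + v)) = - ((N * v + K) * (K * v - 1)) / K"
    using pos by (simp add: field_simps)
  have "q\<^sub>0 v + v * q\<^sub>1 v = A * (K\<^sup>2 + N) * E v / (1 + v) ^ (m + 4) *
      ((1 + v)\<^sup>2 - v * (c + (N + 1) * (1 + v)))"
    unfolding q\<^sub>0_def q\<^sub>1_def using nz by (simp add: power_add divide_simps) (simp add:
        algebra_simps power2_eq_square power4_eq_xxxx)
  also have "\<dots> = - lam * h\<^sub>0 v * f\<^sub>0 v / (1 + v)\<^sup>2"
    unfolding key lam_def h\<^sub>0_def f\<^sub>0_def using nz pd pos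
    by (simp add: power_add divide_simps) (simp add: power2_eq_square power4_eq_xxxx)
  finally show ?thesis .
qed

lemma cmod2: "0 \<le> (cmod z)\<^sup>2" "1 + (cmod z)\<^sup>2 > 0" "1 + (cmod z)\<^sup>2 \<noteq> 0" "N * (cmod z)\<^sup>2 + K \<noteq> 0"
  "N * (cmod z)\<^sup>2 + K > 0" "N + K * (cmod z)\<^sup>2 > 0" "N + K * (cmod z)\<^sup>2 \<noteq> 0"
proof -
  show *: "0 \<le> (cmod z)\<^sup>2" by simp
  show **: "1 + (cmod z)\<^sup>2 > 0" "N * (cmod z)\<^sup>2 + K > 0" "N + K * (cmod z)\<^sup>2 > 0"
    using * one_plus_cmod_square[of z] pos add_pos_nonneg[of N "K * (cmod z)\<^sup>2"] add_nonneg_pos[of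
        "N * (cmod z)\<^sup>2" K]
    by simp_all
  then show "1 + (cmod z)\<^sup>2 \<noteq> 0" "N * (cmod z)\<^sup>2 + K \<noteq> 0" "N + K * (cmod z)\<^sup>2 \<noteq> 0"
    by linarith+
qed

lemma hermitian_metric_h: "hermitian_metric m h"
proof -
  \<comment> \<open>With y the squared modulus of w, substituting v = 1/y gives y^(-2) from the
    squared numerator and y^(m + 2) from the denominator; the resulting y^m is exactly what the
    transition rule divides out.\<close>
  define k where "k w = A * (N + K * (cmod w)\<^sup>2)\<^sup>2 * exp (- c / (1 + (cmod w)\<^sup>2)) / (1 + (cmod
      w)\<^sup>2) ^ (m + 2)" for w
  have "smooth h"
    unfolding h_def[abs_def] h\<^sub>0_def E_def by (intro smooth_intros) (use cmod2 in auto)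
  moreover have "h z > 0" for z
    unfolding h_def by (rule h\<^sub>0_pos) simp
  moreover have "smooth k"
    unfolding k_def[abs_def] by (intro smooth_intros) (use cmod2 in auto)
  moreover have "k w > 0" for w
    unfolding k_def using A cmod2[of w] by (intro divide_pos_pos mult_pos_pos zero_less_power) auto
  moreover have "k w = h (1 / w) / norm w ^ (2 * m)" if "w \<noteq> 0" for w
  proof -
    define y where "y = (cmod w)\<^sup>2"
    have y: "y > 0" "1 + y \<noteq> 0" "1 + 1 / y = (1 + y) / y" "N * (1 / y) + K = (N + K * y) / y"
      "- c * (1 / y) / ((1 + y) / y) = - c / (1 + y)"
      using that by (auto simp: y_def field_simps) (smt (verit) zero_le_power2)
    have "h (1 / w) / norm w ^ (2 * m) = A * ((N + K * y) / y)\<^sup>2 * exp (- c / (1 + y)) / ((1 + y)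
        / y) ^ (m + 2) / y ^ m"
      unfolding h_def h\<^sub>0_def E_def norm_divide norm_one power_divide power_one power_mult
          y_def[symmetric] y(3-5) ..
    also have "\<dots> = A * (N + K * y)\<^sup>2 * exp (- c / (1 + y)) / (1 + y) ^ (m + 2)"
      using y(1,2) by (simp add: power_add power_divide divide_simps power2_eq_square)
    finally show ?thesis
      unfolding k_def y_def by simp
  qed
  ultimately show ?thesis
    unfolding hermitian_metric_def by blast
qed

lemma f_A00: "f \<in> A00 m"
proof -
  define g where "g w = w ^ m * complex_of_real ((K - (cmod w)\<^sup>2) / (N + K * (cmod w)\<^sup>2))" for w
  have "smooth f"
    unfolding f_def[abs_def] f\<^sub>0_def by (intro smooth_intros) (use cmod2 in auto)
  moreover have "smooth g"
    unfolding g_def[abs_def] by (intro smooth_intros) (use cmod2 in auto)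
  moreover have "g w = w ^ m * f (1 / w)" if "w \<noteq> 0" for w
  proof -
    define y where "y = (cmod w)\<^sup>2"
    have y: "y > 0"
      using that by (auto simp: y_def)
    have "f\<^sub>0 (1 / y) = (K - y) / (N + K * y)"
    proof -
      have "K * (1 / y) - 1 = (K - y) / y" "N * (1 / y) + K = (N + K * y) / y"
        using y by (simp_all add: field_simps)
      then show ?thesis
        unfolding f\<^sub>0_def using y by simp
    qed
    then show ?thesis
      unfolding g_def f_def norm_divide norm_one power_divide power_one y_def[symmetric] by simp
  qed
  ultimately show ?thesis
    unfolding A00_def by blast
qed

lemma h\<^sub>0_le: "0 \<le> v \<Longrightarrow> h\<^sub>0 v \<le> A * K\<^sup>2 / (1 + v) ^ m"
proof -
  assume v: "0 \<le> v"
  have "N * v + K \<le> K * (1 + v)"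
    using mult_right_mono[OF pos(4) v] by (simp add: algebra_simps)
  then have "(N * v + K)\<^sup>2 \<le> (K * (1 + v))\<^sup>2"
    using denom_pos[OF v] by (intro power_mono) auto
  then have "A * (N * v + K)\<^sup>2 * E v \<le> A * (K * (1 + v))\<^sup>2 * 1"
    using A E_le_1[OF v] E_pos[of v] by (intro mult_mono mult_left_mono) auto
  then have "h\<^sub>0 v \<le> A * (K * (1 + v))\<^sup>2 * 1 / (1 + v) ^ (m + 2)"
    unfolding h\<^sub>0_def using v by (intro divide_right_mono) auto
  also have "\<dots> = A * K\<^sup>2 / (1 + v) ^ m"
    using v by (simp add: power_add power_mult_distrib power2_eq_square)
  finally show ?thesis .
qed

lemma q\<^sub>0_le: "0 \<le> v \<Longrightarrow> q\<^sub>0 v \<le> A * (K\<^sup>2 + N) / (1 + v) ^ (m + 2)"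
  unfolding q\<^sub>0_def using A E_le_1[of v] pos
  by (intro divide_right_mono mult_left_le) auto

text \<open>The factor v compensates the faster decay of \<open>q\<^sub>1\<close>, so this has the
  same order as the bound for \<open>q\<^sub>0\<close>; the derivative of \<open>Y\<close> contains
  \<open>q\<^sub>1\<close> only with two factors of size |z|.\<close>

lemma q\<^sub>1_le:
  assumes v: "0 \<le> v"
  shows "v * \<bar>q\<^sub>1 v\<bar> \<le> A * (K\<^sup>2 + N) * (c + N + 1) / (1 + v) ^ (m + 2)"
proof -
  have "c + (N + 1) * (1 + v) \<le> (c + N + 1) * (1 + v)"
    using v pos by (simp add: algebra_simps)
  then have "A * (K\<^sup>2 + N) * E v * (v * (c + (N + 1) * (1 + v))) \<le>
      A * (K\<^sup>2 + N) * 1 * ((1 + v) * ((c + N + 1) * (1 + v)))"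
    using A pos E_le_1[OF v] E_pos[of v] v by (intro mult_mono) (auto intro!: mult_nonneg_nonneg)
  then have "A * (K\<^sup>2 + N) * E v * (v * (c + (N + 1) * (1 + v))) / (1 + v) ^ (m + 4) \<le>
      A * (K\<^sup>2 + N) * 1 * ((1 + v) * ((c + N + 1) * (1 + v))) / (1 + v) ^ (m + 4)"
    using v by (intro divide_right_mono) auto
  also have "\<dots> = A * (K\<^sup>2 + N) * (c + N + 1) / (1 + v) ^ (m + 2)"
    using v by (simp add: power_add power4_eq_xxxx power2_eq_square mult_ac)
  also have "A * (K\<^sup>2 + N) * E v * (v * (c + (N + 1) * (1 + v))) / (1 + v) ^ (m + 4) = v * \<bar>q\<^sub>1 v\<bar>"
  proof -
    have "q\<^sub>1 v = - (A * (K\<^sup>2 + N) * E v * (c + (N + 1) * (1 + v)) / (1 + v) ^ (m + 4))"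
      by (simp add: q\<^sub>1_def)
    moreover have "0 \<le> A * (K\<^sup>2 + N) * E v * (c + (N + 1) * (1 + v)) / (1 + v) ^ (m + 4)"
      using v A pos E_pos[of v] by (intro divide_nonneg_pos mult_nonneg_nonneg) auto
    ultimately have "\<bar>q\<^sub>1 v\<bar> = A * (K\<^sup>2 + N) * E v * (c + (N + 1) * (1 + v)) / (1 + v) ^ (m + 4)"
      by (simp only: abs_minus_cancel abs_of_nonneg)
    then show ?thesis
      by (simp add: mult_ac)
  qed
  finally show ?thesis .
qed

end

section \<open>The eigenvalue\<close>

definition fubini_study :: "complex \<Rightarrow> real" where
  "fubini_study z = 1 / (pi * (1 + (cmod z)\<^sup>2)\<^sup>2)"

section \<open>Wirtinger derivatives of radial functions\<close>

lemma has_derivative_radial: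
  assumes "(F has_vector_derivative F') (at ((cmod z)\<^sup>2))"
  shows "((\<lambda>z. F ((cmod z)\<^sup>2)) has_derivative (\<lambda>u. (2 * (z \<bullet> u)) *\<^sub>R F')) (at z)"
proof -
  have "((\<lambda>z. (cmod z)\<^sup>2) has_derivative (\<lambda>u. 2 * (z \<bullet> u))) (at z)"
    unfolding power2_norm_eq_inner by (auto intro!: derivative_eq_intros simp: inner_commute)
  from has_derivative_compose[OF this assms[unfolded has_vector_derivative_def]] show ?thesis
    by simp
qed

lemma d_zbar_eq:
  assumes "(f has_derivative D) (at z)"
  shows "d_zbar f z = (D 1 + \<i> * D \<i>) / 2"
  unfolding d_zbar_def frechet_derivative_at[OF assms, symmetric] ..

lemma d_z_eq:
  assumes "(f has_derivative D) (at z)"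
  shows "d_z f z = (D 1 - \<i> * D \<i>) / 2"
  unfolding d_z_def frechet_derivative_at[OF assms, symmetric] ..

lemma d_zbar_radial:
  fixes F :: "real \<Rightarrow> complex"
  assumes "(F has_vector_derivative F') (at ((cmod z)\<^sup>2))"
  shows "d_zbar (\<lambda>z. F ((cmod z)\<^sup>2)) z = z * F'"
proof -
  have "d_zbar (\<lambda>z. F ((cmod z)\<^sup>2)) z = (of_real (Re z) + \<i> * of_real (Im z)) * F'"
    unfolding d_zbar_eq[OF has_derivative_radial[OF assms]]
    by (simp add: inner_complex_def scaleR_conv_of_real algebra_simps)
  then show ?thesis
    by (simp only: complex_eq[symmetric])
qed

text \<open>The real derivative of z p(|z|^2) in direction u. Both the flux field and the
  \<open>d_zbar\<close> derivative of the logarithm of an invariant metric have the form z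
  p(|z|^2).\<close>

definition radial_mult_deriv :: "(real \<Rightarrow> real) \<Rightarrow> real \<Rightarrow> complex \<Rightarrow> complex \<Rightarrow> complex" where
  "radial_mult_deriv p p' z u = z * ((2 * (z \<bullet> u)) *\<^sub>R of_real p') + u * of_real (p ((cmod z)\<^sup>2))"

lemma has_derivative_radial_mult:
  assumes "(p has_real_derivative p') (at ((cmod z)\<^sup>2))"
  shows "((\<lambda>z. z * complex_of_real (p ((cmod z)\<^sup>2)))
      has_derivative radial_mult_deriv p p' z) (at z)"
proof -
  have "((\<lambda>v. complex_of_real (p v)) has_vector_derivative of_real p') (at ((cmod z)\<^sup>2))"
    by (intro has_vector_derivative_of_real assms)
  from has_derivative_mult[OF has_derivative_ident has_derivative_radial[OF this]] show ?thesis
    unfolding radial_mult_deriv_def[abs_def] .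
qed

text \<open>The \<open>d_z\<close> derivative of |z|^2 is the conjugate of z, so that of z p(v) is
  (v p)'. This turns the eigenvalue equation and the curvature equation into ordinary differential
  equations in v.\<close>

lemma radial_mult_deriv_d_z:
  "(radial_mult_deriv p p' z 1 - \<i> * radial_mult_deriv p p' z \<i>) / 2 =
    of_real (p ((cmod z)\<^sup>2) + (cmod z)\<^sup>2 * p')"
proof -
  have "radial_mult_deriv p p' z 1 - \<i> * radial_mult_deriv p p' z \<i> =
      2 * (of_real p' * (of_real (Re z) - \<i> * of_real (Im z)) * z + of_real (p ((cmod z)\<^sup>2)))"
    by (simp add: radial_mult_deriv_def inner_complex_def scaleR_conv_of_real algebra_simps)
  also have "of_real (Re z) - \<i> * of_real (Im z) = cnj z"
    by (simp add: complex_eq_iff)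
  also have "of_real p' * cnj z * z = of_real ((cmod z)\<^sup>2 * p')"
    by (simp add: complex_norm_square del: of_real_power)
  finally show ?thesis
    by simp
qed

text \<open>Since (1 + r)^2 \<le> 2 (1 + r^2), the denominator is worth 2m + 4 powers of 1 + r. The
  numerator takes 1 + k of them, and k \<le> 2m leaves at least three. The case k = m serves
  products with a section, k = 2m the squared norm of a section.\<close>

lemma radial_decay:
  fixes r B T :: real
  assumes "0 \<le> r" "0 \<le> B" "0 \<le> T" "k \<le> 2 * m"
  shows "B * (1 + r) / (1 + r\<^sup>2) ^ (m + 2) * (T * (1 + r) ^ k) \<le> 2 ^ (m + 2) * B * T / (1 + r) ^ 3"
proof -
  have "(1 + r)\<^sup>2 \<le> 2 * (1 + r\<^sup>2)"
    using sum_squares_ge_zero[of "1 - r" 0] by (simp add: power2_eq_square algebra_simps)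
  then have "((1 + r)\<^sup>2) ^ (m + 2) \<le> (2 * (1 + r\<^sup>2)) ^ (m + 2)"
    by (rule power_mono) simp
  then have "(1 + r) ^ (2 * (m + 2)) \<le> 2 ^ (m + 2) * (1 + r\<^sup>2) ^ (m + 2)"
    unfolding power_mult[symmetric] power_mult_distrib .
  moreover have "(1 + r) ^ (k + 4) \<le> (1 + r) ^ (2 * (m + 2))"
    using assms by (intro power_increasing) auto
  ultimately have "(1 + r) * (1 + r) ^ k * (1 + r) ^ 3 \<le> 2 ^ (m + 2) * (1 + r\<^sup>2) ^ (m + 2)"
    by (simp add: power_add power4_eq_xxxx power3_eq_cube mult_ac)
  moreover have p: "0 < 1 + r\<^sup>2" "0 < 1 + r"
    using assms by (auto intro: add_pos_nonneg)
  ultimately have "(1 + r) * (1 + r) ^ k / (1 + r\<^sup>2) ^ (m + 2) \<le> 2 ^ (m + 2) / (1 + r) ^ 3"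
    using assms p by (simp only: mult_imp_div_pos_le mult_imp_le_div_pos times_divide_eq_left
        zero_less_power)
  then have "B * T * ((1 + r) * (1 + r) ^ k / (1 + r\<^sup>2) ^ (m + 2)) \<le>
      B * T * (2 ^ (m + 2) / (1 + r) ^ 3)"
    using assms by (intro mult_left_mono) auto
  then show ?thesis
    by (simp add: mult_ac)
qed

section \<open>Integration by parts against an arbitrary section\<close>

context test_metric
begin

definition "B = A * (K\<^sup>2 + N) * (c + N + 1)"

lemma B_bounds:
  assumes "0 \<le> v"
  shows "0 \<le> B" "q\<^sub>0 v \<le> B / (1 + v) ^ (m + 2)" "v * \<bar>q\<^sub>1 v\<bar> \<le> B / (1 + v) ^ (m + 2)"
proof -
  show "0 \<le> B"
    unfolding B_def using A pos by (intro mult_nonneg_nonneg) auto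
  have "A * (K\<^sup>2 + N) * 1 \<le> B"
    unfolding B_def using A pos by (intro mult_left_mono) auto
  then have "A * (K\<^sup>2 + N) / (1 + v) ^ (m + 2) \<le> B / (1 + v) ^ (m + 2)"
    using assms by (intro divide_right_mono) auto
  then show "q\<^sub>0 v \<le> B / (1 + v) ^ (m + 2)"
    using q\<^sub>0_le[OF assms] by linarith
  show "v * \<bar>q\<^sub>1 v\<bar> \<le> B / (1 + v) ^ (m + 2)"
    using q\<^sub>1_le[OF assms] unfolding B_def .
qed

text \<open>This is h times \<open>d_zbar f\<close>, the field to which the adjoint Cauchy-Riemann
  operator applies a divergence.\<close>

definition Y :: "complex \<Rightarrow> complex" where "Y z = z * of_real (q\<^sub>0 ((cmod z)\<^sup>2))"
definition Y' :: "complex \<Rightarrow> complex \<Rightarrow> complex" where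
  "Y' z = radial_mult_deriv q\<^sub>0 (q\<^sub>1 ((cmod z)\<^sup>2)) z"

lemma Y_deriv: "(Y has_derivative Y' z) (at z)"
  unfolding Y_def[abs_def] Y'_def by (intro has_derivative_radial_mult q\<^sub>0_deriv) simp

lemma Y'_eq: "Y' z u = of_real (2 * (z \<bullet> u) * q\<^sub>1 ((cmod z)\<^sup>2)) * z + of_real (q\<^sub>0 ((cmod z)\<^sup>2)) *
    u"
  by (simp add: Y'_def radial_mult_deriv_def scaleR_conv_of_real mult_ac)

lemma Y_bounds:
  assumes "norm u = 1"
  shows "norm (Y z) \<le> 3 * B * (1 + cmod z) / (1 + (cmod z)\<^sup>2) ^ (m + 2)"
    "norm (Y' z u) \<le> 3 * B * (1 + cmod z) / (1 + (cmod z)\<^sup>2) ^ (m + 2)"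
proof -
  let ?D = "(1 + (cmod z)\<^sup>2) ^ (m + 2)" and ?v = "(cmod z)\<^sup>2"
  have v: "0 \<le> ?v" by simp
  have D: "0 < ?D" using cmod2 by simp
  have q: "0 \<le> q\<^sub>0 ?v" using q\<^sub>0_nonneg[OF v] .
  note b = B_bounds[OF v]
  have B3: "3 * B / ?D \<le> 3 * B * (1 + cmod z) / ?D"
    using b(1) D by (intro divide_right_mono) (auto simp: distrib_left)
  have "norm (Y z) = cmod z * q\<^sub>0 ?v"
    using q by (simp add: Y_def norm_mult)
  also have "\<dots> \<le> (1 + cmod z) * (3 * B / ?D)"
    using b q D by (intro mult_mono) (auto simp: field_simps)
  finally show "norm (Y z) \<le> 3 * B * (1 + cmod z) / ?D"
    by (simp add: mult.commute)
  have "norm (Y' z u) \<le> 2 * \<bar>z \<bullet> u\<bar> * \<bar>q\<^sub>1 ?v\<bar> * cmod z + q\<^sub>0 ?v"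
    unfolding Y'_eq using q assms
    by (intro order_trans[OF norm_triangle_ineq]) (simp add: norm_mult abs_mult)
  also have "\<dots> \<le> 2 * cmod z * \<bar>q\<^sub>1 ?v\<bar> * cmod z + q\<^sub>0 ?v"
    using Cauchy_Schwarz_ineq2[of z u] assms by (intro add_right_mono mult_right_mono
        mult_left_mono) auto
  also have "\<dots> = 2 * (?v * \<bar>q\<^sub>1 ?v\<bar>) + q\<^sub>0 ?v"
    by (simp add: power2_eq_square)
  also have "\<dots> \<le> 3 * B / ?D"
    using b by simp
  finally show "norm (Y' z u) \<le> 3 * B * (1 + cmod z) / ?D"
    using B3 by linarith
qed

lemma Y'_continuous: "continuous_on UNIV (\<lambda>z. Y' z u)"
  unfolding Y'_eq q\<^sub>0_def q\<^sub>1_def E_def using cmod2 by (intro continuous_intros) auto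

text \<open>The product rule for \<open>Y\<close> times the conjugate of \<open>t\<close>, in
  direction u; the directions 1 and i combine to its \<open>d_z\<close> derivative.\<close>

definition "flux t z u = Y z * cnj (frechet_derivative t (at z) u) + Y' z u * cnj (t z)"

text \<open>The boundary term at infinity vanishes because \<open>Y\<close> decays like |z|^(-2m -
  3) while \<open>t\<close> grows at most like |z|^m; the derivatives in a unit direction obey the
  same bounds.\<close>

lemma integral_flux:
  assumes t: "t \<in> A00 m" and w: "norm w = 1"
  shows "integrable lborel (\<lambda>z. flux t z w)" "(LINT z|lborel. flux t z w) = 0"
proof -
  obtain T where T: "\<And>z. norm (t z) \<le> T * (1 + cmod z) ^ m"
    "\<And>z. norm (frechet_derivative t (at z) w) \<le> T * (1 + cmod z) ^ m"
    using A00_growth[OF t w] by blast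
  have T0: "0 \<le> T"
    using order_trans[OF norm_ge_zero T(1)[of 0]] by simp
  have smt: "smooth t"
    using t by (simp add: A00_def)
  define X where "X z = Y z * cnj (t z)" for z
  define C where "C = 2 * (2 ^ (m + 2) * (3 * B) * T)"
  have B: "0 \<le> 3 * B"
    using B_bounds(1)[of 0] by simp
  have C: "0 \<le> C"
    using B T0 by (simp add: C_def)
  have C_half: "C / 2 = 2 ^ (m + 2) * (3 * B) * T"
    unfolding C_def by (rule nonzero_mult_div_cancel_left) simp
  have bd: "norm (a * cnj b) \<le> (C / 2) / (1 + cmod z) ^ 3"
    if "norm a \<le> 3 * B * (1 + cmod z) / (1 + (cmod z)\<^sup>2) ^ (m + 2)" "norm b \<le>
        T * (1 + cmod z) ^ m" for a b z
  proof -
    have "norm (a * cnj b) \<le> (3 * B * (1 + cmod z) / (1 + (cmod z)\<^sup>2) ^ (m + 2)) * (T * (1 + cmod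
        z) ^ m)"
      unfolding norm_mult complex_mod_cnj by (intro mult_mono that order_trans[OF norm_ge_zero
          that(1)]) auto
    also have "\<dots> \<le> (C / 2) / (1 + cmod z) ^ 3"
      unfolding C_half by (rule radial_decay[OF norm_ge_zero[of z] B T0]) simp
    finally show ?thesis .
  qed
  have Xd: "(X has_derivative flux t z) (at z)" for z
  proof -
    have "((\<lambda>z. cnj (t z)) has_derivative (\<lambda>u. cnj (frechet_derivative t (at z) u))) (at z)"
      by (intro has_derivative_cnj smooth_has_derivative smt)
    from has_derivative_mult[OF Y_deriv this] show ?thesis
      unfolding X_def[abs_def] flux_def[abs_def] .
  qed
  have contY: "continuous_on UNIV Y"
    unfolding continuous_on_eq_continuous_at[OF open_UNIV]
        using has_derivative_continuous[OF Y_deriv] by blast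
  have cont: "continuous_on UNIV (\<lambda>z. flux t z w)"
    unfolding flux_def
    by (intro continuous_intros contY Y'_continuous smooth_imp_continuous_on
        smooth_frechet_derivative smt)
  have bX: "norm (X z) \<le> C / (1 + cmod z) ^ 3" for z
  proof -
    have "norm (X z) \<le> (C / 2) / (1 + cmod z) ^ 3"
      unfolding X_def by (intro bd Y_bounds(1)[OF w] T)
    also have "\<dots> \<le> C / (1 + cmod z) ^ 3"
      using C by (intro divide_right_mono) auto
    finally show ?thesis .
  qed
  have bX': "norm (flux t z w) \<le> C / (1 + cmod z) ^ 3" for z
  proof -
    have "norm (flux t z w) \<le> (C / 2) / (1 + cmod z) ^ 3 + (C / 2) / (1 + cmod z) ^ 3"
      unfolding flux_def by (rule norm_triangle_le) (intro add_mono bd Y_bounds[OF w] T)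
    then show ?thesis
      by (simp add: add_divide_distrib[symmetric])
  qed
  show "integrable lborel (\<lambda>z. flux t z w)"
    by (rule integrable_of_cubic_decay[OF cont bX'])
  show "(LINT z|lborel. flux t z w) = 0"
    by (rule integral_directional_derivative[OF Xd cont w bX bX'])
qed

lemma d_zbar_f: "d_zbar f z = z * of_real (f\<^sub>1 ((cmod z)\<^sup>2))"
  unfolding f_def[abs_def]
  by (intro d_zbar_radial[of "\<lambda>v. complex_of_real (f\<^sub>0 v)"] has_vector_derivative_of_real
      f\<^sub>0_deriv) simp

text \<open>The integrand h \<open>d_zbar f\<close> conj(\<open>d_zbar t\<close>) is the
  \<open>d_z\<close> derivative of \<open>Y\<close> conj(t) minus (\<open>d_z Y\<close>) conj(t).
  The first part integrates to 0. By \<open>flux_deriv\<close>, \<open>d_z Y\<close> is - pi lam f h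
  times the Fubini-Study density, and this pi cancels the one in \<open>inner_01\<close>.\<close>

lemma laplacian_f: "laplacian_rel m fubini_study h f (\<lambda>z. of_real lam * f z)"
proof -
  have "(\<lambda>z. of_real lam * f z) \<in> A00 m"
  proof -
    obtain g where "smooth g" "\<And>w. w \<noteq> 0 \<Longrightarrow> g w = w ^ m * f (1 / w)"
      using f_A00 unfolding A00_def by blast
    moreover have "smooth f"
      using f_A00 unfolding A00_def by blast
    ultimately show ?thesis
      unfolding A00_def
      by (auto intro!: smooth_intros exI[of _ "\<lambda>w. of_real lam * g w"])
  qed
  moreover have "inner_00 fubini_study h (\<lambda>z. of_real lam * f z) t =
      inner_01 h (d_zbar f) (d_zbar t)"
    if t: "t \<in> A00 m" for t
  proof -
    define a where "a z = of_real lam * f z * cnj (t z) * of_real (h z) * of_real (fubini_study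
        z)" for z
    define b where "b z = d_zbar f z * cnj (d_zbar t z) * of_real (h z)" for z
    define d where "d z = (flux t z 1 - \<i> * flux t z \<i>) / 2" for z
    have smt: "smooth t"
      using t by (simp add: A00_def)
    have d_int: "integrable lborel d" "(LINT z|lborel. d z) = 0"
      unfolding d_def[abs_def] using integral_flux[OF t, of 1] integral_flux[OF t, of \<i>] by auto
    have a_eq: "of_real pi * a z = - of_real (q\<^sub>0 ((cmod z)\<^sup>2) + (cmod z)\<^sup>2 * q\<^sub>1 ((cmod z)\<^sup>2)) *
        cnj (t z)" for z
      unfolding a_def flux_deriv[OF zero_le_power2] f_def h_def fubini_study_def by simp
    have b_eq: "b z = Y z * cnj (d_zbar t z)" for z
      unfolding b_def d_zbar_f Y_def h_def h\<^sub>0_times_f\<^sub>1[OF zero_le_power2, symmetric] by simp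
    have ba: "b z = d z + of_real pi * a z" for z
    proof -
      have Y: "(Y' z 1 - \<i> * Y' z \<i>) / 2 = of_real (q\<^sub>0 ((cmod z)\<^sup>2) + (cmod z)\<^sup>2 * q\<^sub>1 ((cmod
          z)\<^sup>2))"
        unfolding Y'_def by (rule radial_mult_deriv_d_z)
      have "d z = Y z * cnj (d_zbar t z) + (Y' z 1 - \<i> * Y' z \<i>) / 2 * cnj (t z)"
        unfolding d_def flux_def d_zbar_def by (simp add: algebra_simps diff_divide_distrib
            add_divide_distrib)
      then show ?thesis
        unfolding a_eq b_eq Y by (simp add: algebra_simps)
    qed
    \<comment> \<open>Integrability of this summand is required before the integral of b = d + pi a
      may be split.\<close>
    have "integrable lborel (\<lambda>z. of_real pi * a z)"
    proof -
      obtain T where T: "\<And>z. norm (t z) \<le> T * (1 + cmod z) ^ m"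
        by (rule A00_growth[OF t, of 1]) auto
      have T0: "0 \<le> T"
        using order_trans[OF norm_ge_zero T(1)[of 0]] by simp
      have B: "0 \<le> 2 * B"
        using B_bounds(1)[of 0] by simp
      show ?thesis
      proof (rule integrable_of_cubic_decay)
        show "continuous_on UNIV (\<lambda>z. of_real pi * a z)"
          unfolding a_eq q\<^sub>0_def q\<^sub>1_def E_def
          using cmod2 by (intro continuous_intros smooth_imp_continuous_on smt) auto
        fix z
        let ?v = "(cmod z)\<^sup>2"
        have v: "0 \<le> ?v" by simp
        have "\<bar>q\<^sub>0 ?v + ?v * q\<^sub>1 ?v\<bar> \<le> q\<^sub>0 ?v + ?v * \<bar>q\<^sub>1 ?v\<bar>"
          using q\<^sub>0_nonneg[OF v] by (intro order_trans[OF abs_triangle_ineq]) (simp add: abs_mult)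
        also have "\<dots> \<le> 2 * B / (1 + ?v) ^ (m + 2)"
          using B_bounds[OF v] by simp
        also have "\<dots> \<le> 2 * B * (1 + cmod z) / (1 + ?v) ^ (m + 2)"
          using B by (intro divide_right_mono) (auto simp: distrib_left)
        finally have *: "\<bar>q\<^sub>0 ?v + ?v * q\<^sub>1 ?v\<bar> \<le> 2 * B * (1 + cmod z) / (1 + ?v) ^ (m + 2)" .
        have "norm (of_real pi * a z) \<le> 2 * B * (1 + cmod z) / (1 + ?v) ^ (m + 2) * (T * (1 + cmod
            z) ^ m)"
          unfolding a_eq norm_mult complex_mod_cnj norm_minus_cancel norm_of_real
          by (rule mult_mono[OF * T order_trans[OF abs_ge_zero *] norm_ge_zero])
        then show "norm (of_real pi * a z) \<le> 2 ^ (m + 2) * (2 * B) * T / (1 + cmod z) ^ 3"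
          using radial_decay[OF norm_ge_zero[of z] B T0, of m m] by linarith
      qed
    qed
    then have "(LINT z|lborel. b z) = of_real pi * (LINT z|lborel. a z)"
      unfolding ba using d_int by simp
    then show ?thesis
      unfolding inner_00_def inner_01_def a_def[symmetric] b_def[symmetric] by simp
  qed
  ultimately show ?thesis
    unfolding laplacian_rel_def dbar_adjoint_rel_def using f_A00 by blast
qed

lemma S1_invariant_h: "S1_invariant h" and S1_invariant_f: "S1_invariant f"
  by (simp_all add: S1_invariant_def h_def f_def norm_mult)

lemma invariant_eigenvalue_lam: "invariant_eigenvalue m fubini_study h lam"
proof -
  have "f 0 \<noteq> 0"
    using pos by (simp add: f_def f\<^sub>0_def)
  then show ?thesis
    unfolding invariant_eigenvalue_def using laplacian_f S1_invariant_f by (metis (no_types))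
qed

end

section \<open>The weighted Poincare inequality\<close>

text \<open>For the continuity of \<open>\<Phi>\<close> at the zero of \<open>f\<^sub>0\<close>,
  where one factor of the numerator is absorbed into a difference quotient.\<close>

lemma difference_quotient_tendsto:
  fixes f :: "real \<Rightarrow> 'a::real_normed_vector"
  assumes "(f has_vector_derivative D) (at x)"
  shows "((\<lambda>y. (1 / (y - x)) *\<^sub>R (f y - f x)) \<longlongrightarrow> D) (at x)"
proof -
  have "((\<lambda>y. norm (f y - f x - (y - x) *\<^sub>R D) / norm (y - x)) \<longlongrightarrow> 0) (at x)"
    using assms unfolding has_vector_derivative_def has_derivative_iff_norm by blast
  moreover have "norm (f y - f x - (y - x) *\<^sub>R D) / norm (y - x) =
      norm ((1 / (y - x)) *\<^sub>R (f y - f x) - D)" if "y \<noteq> x" for y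
  proof -
    have "(1 / (y - x)) *\<^sub>R (f y - f x) - D = (1 / (y - x)) *\<^sub>R (f y - f x - (y - x) *\<^sub>R D)"
      using that by (simp add: scaleR_diff_right)
    then show ?thesis
      by (simp add: divide_inverse mult.commute)
  qed
  then have "eventually (\<lambda>y. norm (f y - f x - (y - x) *\<^sub>R D) / norm (y - x) =
      norm ((1 / (y - x)) *\<^sub>R (f y - f x) - D)) (at x)"
    by (simp add: eventually_at_filter)
  ultimately have "((\<lambda>y. norm ((1 / (y - x)) *\<^sub>R (f y - f x) - D)) \<longlongrightarrow> 0) (at x)"
    by (rule Lim_transform_eventually)
  then show ?thesis
    by (simp add: LIM_zero_cancel tendsto_norm_zero_iff)
qed

context test_metric
begin

text \<open>Write \<open>S - S (1 / K) = f\<^sub>0 g\<close>, with \<open>1 / K\<close> the zero of \<open>f\<^sub>0\<close>. The difference of the two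
  integrands is the derivative of \<open>\<Phi> = v q\<^sub>0 f\<^sub>0 \<bar>g\<bar>\<^sup>2\<close> plus the nonnegative term \<open>v h\<^sub>0 f\<^sub>0\<^sup>2
      \<bar>g'\<bar>\<^sup>2\<close>, and
  \<open>\<Phi>\<close> vanishes at \<open>0\<close> and is nonnegative beyond \<open>1 / K\<close>.\<close>

lemma weighted_poincare:
  fixes S S' :: "real \<Rightarrow> complex" and e :: "real \<Rightarrow> real"
  defines "v\<^sub>0 \<equiv> 1 / K"
  assumes S': "\<And>v. 0 < v \<Longrightarrow> (S has_vector_derivative S' v) (at v)"
    and cont: "continuous_on {0..} S"
    and e: "\<And>v. 0 < v \<Longrightarrow> e v = v * h\<^sub>0 v * (norm (S' v))\<^sup>2"
    and int_e: "set_integrable lborel {0..} e"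
    and int: "set_integrable lborel {0..} (\<lambda>v. (norm (S v - S v\<^sub>0))\<^sup>2 * (h\<^sub>0 v / (1 + v)\<^sup>2))"
  shows "lam * (LINT v:{0..}|lborel. (norm (S v - S v\<^sub>0))\<^sup>2 * (h\<^sub>0 v / (1 + v)\<^sup>2)) \<le>
      (LINT v:{0..}|lborel. e v)"
proof -
  define U where "U v = S v - S v\<^sub>0" for v
  define \<psi> where "\<psi> v = e v - lam * ((norm (U v))\<^sup>2 * (h\<^sub>0 v / (1 + v)\<^sup>2))" for v
  \<comment> \<open>With U = \<open>f\<^sub>0\<close> g this is v \<open>f\<^sub>0\<close> |g|^2
    times \<open>q\<^sub>0\<close>. At the zero of \<open>f\<^sub>0\<close> division by zero gives
    the value 0, which is also the limit.\<close>
  define \<Phi> where "\<Phi> v = v * q\<^sub>0 v * (norm (U v))\<^sup>2 / f\<^sub>0 v" for v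
  define \<Phi>' where "\<Phi>' v = (q\<^sub>0 v + v * q\<^sub>1 v) * (norm (U v))\<^sup>2 / f\<^sub>0 v +
    v * q\<^sub>0 v * (2 * (U v \<bullet> S' v) * f\<^sub>0 v - (norm (U v))\<^sup>2 * f\<^sub>1 v) / (f\<^sub>0 v)\<^sup>2" for v
  have v0: "0 < v\<^sub>0" and f0_zero: "f\<^sub>0 v\<^sub>0 = 0"
    using pos by (auto simp: v\<^sub>0_def f\<^sub>0_def)
  have f0_eq: "f\<^sub>0 v = K * (v - v\<^sub>0) / (N * v + K)" for v
    using pos by (simp add: f\<^sub>0_def v\<^sub>0_def right_diff_distrib)
  have f0_nz: "f\<^sub>0 v \<noteq> 0" if "0 \<le> v" "v \<noteq> v\<^sub>0" for v
    using that pos denom_pos[OF that(1)] by (auto simp: f0_eq)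
  have U': "(U has_vector_derivative S' v) (at v)" if "0 < v" for v
    unfolding U_def[abs_def] by (auto intro!: derivative_eq_intros S' that)
  have contU: "continuous_on {0..} U"
    unfolding U_def[abs_def] by (intro continuous_intros cont)
  have U0: "U v\<^sub>0 = 0"
    by (simp add: U_def)
  have \<Phi>_deriv: "(\<Phi> has_real_derivative \<Phi>' v) (at v)" if "0 < v" "v \<noteq> v\<^sub>0" for v
  proof -
    have n: "((\<lambda>v. (norm (U v))\<^sup>2) has_real_derivative 2 * (U v \<bullet> S' v)) (at v)"
      unfolding power2_norm_eq_inner has_real_derivative_iff_has_vector_derivative
          has_vector_derivative_def
      using U'[OF that(1), unfolded has_vector_derivative_def]
      by (auto intro!: derivative_eq_intros simp: inner_commute algebra_simps)
    have v: "0 \<le> v" using that by simp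
    have "(\<Phi> has_real_derivative (((1 * q\<^sub>0 v + q\<^sub>1 v * v) * (norm (U v))\<^sup>2 + 2 * (U v \<bullet> S' v) *
        (v * q\<^sub>0 v)) * f\<^sub>0 v -
        v * q\<^sub>0 v * (norm (U v))\<^sup>2 * f\<^sub>1 v) / (f\<^sub>0 v * f\<^sub>0 v)) (at v)"
      unfolding \<Phi>_def[abs_def]
      by (intro DERIV_divide DERIV_mult DERIV_ident q\<^sub>0_deriv f\<^sub>0_deriv n f0_nz v that)
    moreover have "(((1 * q\<^sub>0 v + q\<^sub>1 v * v) * (norm (U v))\<^sup>2 + 2 * (U v \<bullet> S' v) * (v * q\<^sub>0 v)) *
        f\<^sub>0 v -
        v * q\<^sub>0 v * (norm (U v))\<^sup>2 * f\<^sub>1 v) / (f\<^sub>0 v * f\<^sub>0 v) = \<Phi>' v"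
      unfolding \<Phi>'_def using f0_nz[OF v that(2)] by (simp add: field_simps power2_eq_square)
    ultimately show ?thesis
      by simp
  qed
  have le: "\<Phi>' v \<le> \<psi> v" if "0 < v" "v \<noteq> v\<^sub>0" for v
  proof -
    have v: "0 \<le> v" using that by simp
    note nz = f0_nz[OF v that(2)]
    \<comment> \<open>The logarithmic derivative of \<open>f\<^sub>0\<close>: then S' - r U equals
      \<open>f\<^sub>0\<close> g', and the square below is the nonnegative remainder.\<close>
    define r where "r = f\<^sub>1 v / f\<^sub>0 v"
    have "0 \<le> (norm (S' v - r *\<^sub>R U v))\<^sup>2"
      by simp
    also have "\<dots> = (norm (S' v))\<^sup>2 - 2 * r * (U v \<bullet> S' v) + r\<^sup>2 * (norm (U v))\<^sup>2"
      unfolding power2_norm_eq_inner by (simp add: inner_diff inner_commute power2_eq_square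
          algebra_simps)
    finally have "v * h\<^sub>0 v * (2 * r * (U v \<bullet> S' v) - r\<^sup>2 * (norm (U v))\<^sup>2) \<le>
        v * h\<^sub>0 v * (norm (S' v))\<^sup>2"
      using v h\<^sub>0_pos[OF v] by (intro mult_left_mono) auto
    moreover have "v * h\<^sub>0 v * (2 * r * (U v \<bullet> S' v) - r\<^sup>2 * (norm (U v))\<^sup>2) =
        v * q\<^sub>0 v * (2 * (U v \<bullet> S' v) * f\<^sub>0 v - (norm (U v))\<^sup>2 * f\<^sub>1 v) / (f\<^sub>0 v)\<^sup>2"
      unfolding h\<^sub>0_times_f\<^sub>1[OF v, symmetric] r_def using nz
          by (simp add: field_simps power2_eq_square)
    moreover have "(q\<^sub>0 v + v * q\<^sub>1 v) * (norm (U v))\<^sup>2 / f\<^sub>0 v =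
        - lam * ((norm (U v))\<^sup>2 * (h\<^sub>0 v / (1 + v)\<^sup>2))"
      unfolding flux_deriv[OF v] using nz by simp
    ultimately show ?thesis
      unfolding \<Phi>'_def \<psi>_def e[OF that(1)] by linarith
  qed
  have contPhi: "continuous_on {0..R} \<Phi>" for R
    unfolding continuous_on_eq_continuous_within
  proof
    fix v assume "v \<in> {0..R}"
    then have v: "0 \<le> v" by simp
    show "continuous (at v within {0..R}) \<Phi>"
    proof (cases "v = v\<^sub>0")
      case False
      have "continuous (at v within {0..R}) U"
        using contU v continuous_on_subset[OF contU, of "{0..R}"] \<open>v \<in> {0..R}\<close>
        by (auto simp: continuous_on_eq_continuous_within)
      moreover have "isCont q\<^sub>0 v" "isCont f\<^sub>0 v"
        using q\<^sub>0_deriv[OF v] f\<^sub>0_deriv[OF v] by (auto intro: DERIV_isCont)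
      ultimately show ?thesis
        unfolding \<Phi>_def[abs_def]
        by (intro continuous_intros) (use f0_nz[OF v False] in \<open>auto intro:
            continuous_at_imp_continuous_within\<close>)
    next
      case True
      \<comment> \<open>The simple zero of \<open>f\<^sub>0\<close> divides one of the two factors
        U, giving a difference quotient with limit S'; the other factor U tends to 0.\<close>
      have "((\<lambda>v. v * q\<^sub>0 v * (N * v + K) / K * (U v \<bullet> ((1 / (v - v\<^sub>0)) *\<^sub>R (U v - U v\<^sub>0))))
          \<longlongrightarrow> v\<^sub>0 * q\<^sub>0 v\<^sub>0 * (N * v\<^sub>0 + K) / K * (U v\<^sub>0 \<bullet> S' v\<^sub>0)) (at v\<^sub>0)"
      proof (intro tendsto_intros difference_quotient_tendsto U' v0)
        show "(q\<^sub>0 \<longlongrightarrow> q\<^sub>0 v\<^sub>0) (at v\<^sub>0)"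
          using DERIV_isCont[OF q\<^sub>0_deriv] v0 by (auto simp: isCont_def)
        show "(U \<longlongrightarrow> U v\<^sub>0) (at v\<^sub>0)"
          using has_vector_derivative_continuous[OF U'[OF v0]] by (simp add: isCont_def)
      qed (use pos in auto)
      moreover have "eventually (\<lambda>v. v * q\<^sub>0 v * (N * v + K) / K * (U v \<bullet> ((1 / (v - v\<^sub>0)) *\<^sub>R (U
          v - U v\<^sub>0))) = \<Phi> v) (at v\<^sub>0)"
        by (rule eventuallyI) (simp add: \<Phi>_def f0_eq U0 power2_norm_eq_inner)
      ultimately have "(\<Phi> \<longlongrightarrow> \<Phi> v\<^sub>0) (at v\<^sub>0)"
        by (simp add: U0 \<Phi>_def f0_zero Lim_transform_eventually)
      then show ?thesis
        unfolding True by (auto simp: isCont_def intro: continuous_at_imp_continuous_within)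
    qed
  qed
  have int_\<psi>: "set_integrable lborel {0..} \<psi>"
    unfolding \<psi>_def[abs_def] U_def using int_e int
        by (intro set_integral_diff set_integrable_mult_right) auto
  have nonneg: "0 \<le> (LINT v:{0..R}|lborel. \<psi> v)" if R: "v\<^sub>0 < R" for R
  proof -
    \<comment> \<open>At 0 and at the zero of \<open>f\<^sub>0\<close> no derivative of
      \<open>\<Phi>\<close> is available; taking the value of \<open>\<psi>\<close> there keeps the
      comparison valid on the whole interval.\<close>
    define g where "g v = (if v = 0 \<or> v = v\<^sub>0 then \<psi> v else \<Phi>' v)" for v
    have "(g has_integral \<Phi> R - \<Phi> 0) {0..R}"
      by (rule fundamental_theorem_of_calculus_interior_strong[where S="{v\<^sub>0}"])
        (use R v0 \<Phi>_deriv contPhi in \<open>auto simp: g_def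
            has_real_derivative_iff_has_vector_derivative[symmetric]\<close>)
    moreover have "set_integrable lborel {0..R} \<psi>"
      by (rule set_integrable_subset[OF int_\<psi>]) auto
    then have "(\<psi> has_integral (LINT v:{0..R}|lborel. \<psi> v)) {0..R}"
      using set_borel_integral_eq_integral by (metis integrable_integral)
    moreover have "g v \<le> \<psi> v" if "v \<in> {0..R}" for v
      using le that by (auto simp: g_def)
    ultimately have "\<Phi> R - \<Phi> 0 \<le> (LINT v:{0..R}|lborel. \<psi> v)"
      by (rule has_integral_le)
    moreover have "0 \<le> \<Phi> R"
      unfolding \<Phi>_def f0_eq using R v0 pos q\<^sub>0_nonneg[of R] denom_pos[of R]
      by (intro divide_nonneg_nonneg mult_nonneg_nonneg) auto
    ultimately show ?thesis
      by (simp add: \<Phi>_def)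
  qed
  have "((\<lambda>R. LINT v:{0..R}|lborel. \<psi> v) \<longlongrightarrow> (LINT v:{0..}|lborel. \<psi> v)) at_top"
    by (rule tendsto_set_lebesgue_integral_at_top[OF _ int_\<psi>]) auto
  then have "0 \<le> (LINT v:{0..}|lborel. \<psi> v)"
    by (rule tendsto_lowerbound[OF _ eventually_mono[OF eventually_gt_at_top[of v\<^sub>0]]]) (use
        nonneg in auto)
  also have "\<dots> = (LINT v:{0..}|lborel. e v) - lam * (LINT v:{0..}|lborel. (norm (U v))\<^sup>2 * (h\<^sub>0 v
      / (1 + v)\<^sup>2))"
    unfolding \<psi>_def U_def
    by (subst set_integral_diff(2)[OF int_e])
      (simp_all only: set_integrable_mult_right int set_integral_mult_right)
  finally show ?thesis
    by (simp add: U_def)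
qed

end

section \<open>The lower bound for the spectrum\<close>

lemma continuous_AE_zero:
  fixes s :: "complex \<Rightarrow> complex"
  assumes "continuous_on UNIV s" "AE z in lborel. s z = 0"
  shows "s = (\<lambda>z. 0)"
proof (rule ccontr)
  assume "s \<noteq> (\<lambda>z. 0)"
  then have "{z. s z \<noteq> 0} \<noteq> {}"
    by auto
  moreover have op: "open {z. s z \<noteq> 0}"
    by (intro open_Collect_neq assms continuous_on_const)
  moreover have "{z. s z \<noteq> 0} \<in> null_sets lborel"
    using assms(2) op by (subst (asm) AE_iff_null) (simp_all add: borel_open)
  then have "negligible {z. s z \<noteq> 0}"
    unfolding negligible_iff_null_sets by (rule null_sets_completionI)
  ultimately show False
    using open_not_negligible by blast
qed

lemma S1_invariant_cmod:
  assumes "S1_invariant s"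
  shows "s z = s (of_real (cmod z))"
proof -
  have "s (cis (Arg z) * of_real (cmod z)) = s (of_real (cmod z))"
    using assms unfolding S1_invariant_def by blast
  then show ?thesis
    using rcis_cmod_Arg[of z] by (simp add: rcis_def mult.commute)
qed

lemma has_vector_derivative_along_ray:
  fixes s :: "complex \<Rightarrow> 'b::real_normed_vector"
  assumes "(s has_derivative D) (at (of_real (sqrt v)))" "0 < v"
  shows "((\<lambda>v. s (of_real (sqrt v))) has_vector_derivative (1 / (2 * sqrt v)) *\<^sub>R D 1) (at v)"
proof -
  interpret bounded_linear D
    using assms(1) by (rule has_derivative_bounded_linear)
  have "((\<lambda>v. complex_of_real (sqrt v)) has_vector_derivative of_real (inverse (sqrt v) / 2)) (at
      v)"
    by (intro has_vector_derivative_of_real DERIV_real_sqrt assms)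
  from has_derivative_compose[OF this[unfolded has_vector_derivative_def] assms(1)]
  have "((\<lambda>v. s (of_real (sqrt v))) has_derivative (\<lambda>h. D (h *\<^sub>R of_real (inverse (sqrt v) / 2))))
      (at v)" .
  moreover have "D (h *\<^sub>R of_real (inverse (sqrt v) / 2)) = h *\<^sub>R ((1 / (2 * sqrt v)) *\<^sub>R D 1)"
      for h
  proof -
    have "h *\<^sub>R complex_of_real (inverse (sqrt v) / 2) = (h * (1 / (2 * sqrt v))) *\<^sub>R 1"
      by (simp add: complex_eq_iff inverse_eq_divide)
    then show ?thesis
      by (simp only: scaleR scaleR_scaleR)
  qed
  ultimately show ?thesis
    by (simp add: has_vector_derivative_def)
qed

lemma fubini_study_pos: "fubini_study z > 0"
  unfolding fubini_study_def
  by (intro divide_pos_pos mult_pos_pos zero_less_power add_pos_nonneg) auto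

context test_metric
begin

definition "wt z = h z * fubini_study z"

lemma h_pos: "h z > 0"
  unfolding h_def by (rule h\<^sub>0_pos) simp

lemma wt_pos: "wt z > 0"
  unfolding wt_def by (intro mult_pos_pos h_pos fubini_study_pos)

lemma continuous_on_h: "continuous_on UNIV h"
  unfolding h_def[abs_def] h\<^sub>0_def E_def using cmod2 by (intro continuous_intros) auto

lemma wt_continuous: "continuous_on UNIV wt"
  unfolding wt_def[abs_def] fubini_study_def using cmod2
  by (intro continuous_intros continuous_on_h) auto

text \<open>The weight decays like (1 + v)^(-m - 2), which leaves room for growth of order 2m, the
  order of the squared norm of a section.\<close>

lemma integrable_wt:
  fixes \<phi> :: "complex \<Rightarrow> 'b::{banach, second_countable_topology}"
  assumes cont: "continuous_on UNIV \<phi>" and le: "\<And>z. norm (\<phi> z) \<le> T * (1 + cmod z) ^ k"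
      and k: "k \<le> 2 * m"
  shows "integrable lborel (\<lambda>z. wt z *\<^sub>R \<phi> z)"
proof (rule integrable_of_cubic_decay)
  show "continuous_on UNIV (\<lambda>z. wt z *\<^sub>R \<phi> z)"
    by (intro continuous_intros cont wt_continuous)
  fix z
  have T: "0 \<le> T"
    using order_trans[OF norm_ge_zero le[of 0]] by simp
  let ?v = "(cmod z)\<^sup>2"
  have B: "0 \<le> A * K\<^sup>2"
    using A by simp
  have "fubini_study z \<le> 1 / (1 + ?v)\<^sup>2"
    unfolding fubini_study_def using cmod2(2)[of z] pi_ge_two by (intro divide_left_mono) auto
  then have "wt z \<le> A * K\<^sup>2 / (1 + ?v) ^ m * (1 / (1 + ?v)\<^sup>2)"
    unfolding wt_def h_def using B cmod2(2)[of z]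
    by (intro mult_mono h\<^sub>0_le less_imp_le[OF fubini_study_pos]) auto
  also have "\<dots> = A * K\<^sup>2 / (1 + ?v) ^ (m + 2)"
    by (simp add: power_add power2_eq_square)
  also have "\<dots> \<le> A * K\<^sup>2 * (1 + cmod z) / (1 + ?v) ^ (m + 2)"
    using B by (intro divide_right_mono) (auto simp: distrib_left)
  finally have *: "wt z \<le> A * K\<^sup>2 * (1 + cmod z) / (1 + ?v) ^ (m + 2)" .
  then have "norm (wt z *\<^sub>R \<phi> z) \<le> A * K\<^sup>2 * (1 + cmod z) / (1 + ?v) ^ (m + 2) * (T * (1 + cmod z)
      ^ k)"
    unfolding norm_scaleR abs_of_pos[OF wt_pos]
    by (rule mult_mono[OF _ le order_trans[OF less_imp_le[OF wt_pos] *] norm_ge_zero])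
  then show "norm (wt z *\<^sub>R \<phi> z) \<le> 2 ^ (m + 2) * (A * K\<^sup>2) * T / (1 + cmod z) ^ 3"
    using radial_decay[OF norm_ge_zero[of z] B T k] by linarith
qed

lemma one_A00: "(\<lambda>z. 1) \<in> A00 m"
  unfolding A00_def by (auto intro!: smooth_intros exI[of _ "\<lambda>w. w ^ m"])

text \<open>Testing the weak equation against the constant section, which \<open>d_zbar\<close>
  kills, shows that s has weighted mean 0, as l > 0; testing against s gives the energy identity.
  Mean 0 means that subtracting a constant a does not decrease the norm. With a the value of s where
  |z|^2 = 1/K, the Poincare inequality bounds lam times the norm by the energy.\<close>

lemma invariant_eigenvalue_ge_lam:
  assumes "invariant_eigenvalue m fubini_study h l" and l: "0 < l"
  shows "lam \<le> l"
proof -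
  obtain s where s0: "s \<noteq> (\<lambda>z. 0)" and inv: "S1_invariant s"
    and lap: "laplacian_rel m fubini_study h s (\<lambda>z. of_real l * s z)"
    using assms(1) unfolding invariant_eigenvalue_def by blast
  have sA: "s \<in> A00 m" and weak: "\<And>t. t \<in> A00 m \<Longrightarrow>
      inner_00 fubini_study h (\<lambda>z. of_real l * s z) t = inner_01 h (d_zbar s) (d_zbar t)"
    using lap unfolding laplacian_rel_def dbar_adjoint_rel_def by blast+
  have sms: "smooth s"
    using sA by (simp add: A00_def)
  note cs = smooth_imp_continuous_on[OF sms]
  obtain T where T: "\<And>z. norm (s z) \<le> T * (1 + cmod z) ^ m"
    by (rule A00_growth[OF sA, of 1]) auto
  define J where "J = (LINT z|lborel. wt z *\<^sub>R (norm (s z))\<^sup>2)"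
  have int_s: "integrable lborel (\<lambda>z. wt z *\<^sub>R s z)"
    by (rule integrable_wt[OF cs T]) simp
  have int_s2: "integrable lborel (\<lambda>z. wt z *\<^sub>R (norm (s z))\<^sup>2)"
  proof (rule integrable_wt)
    show "norm ((norm (s z))\<^sup>2) \<le> T\<^sup>2 * (1 + cmod z) ^ (2 * m)" for z
    proof -
      have "(norm (s z))\<^sup>2 \<le> (T * (1 + cmod z) ^ m)\<^sup>2"
        by (rule power_mono[OF T norm_ge_zero])
      also have "\<dots> = T\<^sup>2 * (1 + cmod z) ^ (2 * m)"
        by (simp only: power_mult_distrib power_mult[symmetric] mult.commute[of m])
      finally show ?thesis
        by simp
    qed
  qed (intro continuous_intros cs, simp)
  have int_1: "integrable lborel (\<lambda>z. wt z *\<^sub>R (1::real))"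
    by (rule integrable_wt[where T=1 and k=0]) auto
  have J: "0 < J"
  proof -
    have nn: "0 \<le> wt z *\<^sub>R (norm (s z))\<^sup>2" for z
      using less_imp_le[OF wt_pos[of z]] by simp
    then have "0 \<le> J"
      unfolding J_def by simp
    moreover have "J \<noteq> 0"
    proof
      assume "J = 0"
      then have "AE z in lborel. wt z *\<^sub>R (norm (s z))\<^sup>2 = 0"
        unfolding J_def using integral_nonneg_eq_0_iff_AE[OF int_s2 AE_I2[OF nn]] by blast
      then have "AE z in lborel. s z = 0"
      proof (rule AE_mp, intro AE_I2 impI)
        fix z assume "wt z *\<^sub>R (norm (s z))\<^sup>2 = 0"
        then show "s z = 0"
          using wt_pos[of z] by simp
      qed
      then show False
        using continuous_AE_zero[OF cs] s0 by blast
    qed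
    ultimately show ?thesis by simp
  qed
  have mean: "(LINT z|lborel. wt z *\<^sub>R s z) = 0"
  proof -
    have "of_real l * s z * cnj 1 * of_real (h z) * of_real (fubini_study z) =
        of_real l * (wt z *\<^sub>R s z)" for z
      by (simp add: wt_def scaleR_conv_of_real)
    then have "inner_00 fubini_study h (\<lambda>z. of_real l * s z) (\<lambda>z. 1) =
        of_real l * (LINT z|lborel. wt z *\<^sub>R s z)"
      unfolding inner_00_def by (simp only: integral_mult_right_zero)
    moreover have "d_zbar (\<lambda>z. 1) = (\<lambda>z. 0)"
      by (rule ext, subst d_zbar_eq[OF has_derivative_const]) simp
    ultimately show ?thesis
      using weak[OF one_A00] l by (simp add: inner_01_def)
  qed
  define W where "W z = (norm (d_zbar s z))\<^sup>2 * h z" for z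
  have energy: "pi * (l * J) = (LINT z|lborel. W z)"
  proof -
    have "of_real l * s z * cnj (s z) * of_real (h z) * of_real (fubini_study z) =
        complex_of_real (l * (wt z *\<^sub>R (norm (s z))\<^sup>2))" for z
      by (simp only: wt_def of_real_mult real_scaleR_def complex_norm_square) (simp only: mult_ac)
    then have 1: "inner_00 fubini_study h (\<lambda>z. of_real l * s z) s = of_real (l * J)"
      unfolding inner_00_def J_def by (simp only: integral_complex_of_real integral_mult_right_zero)
    have "d_zbar s z * cnj (d_zbar s z) * of_real (h z) = complex_of_real (W z)" for z
      by (simp only: W_def of_real_mult complex_norm_square)
    then have 2: "inner_01 h (d_zbar s) (d_zbar s) = of_real ((LINT z|lborel. W z) / pi)"
      unfolding inner_01_def by (simp only: integral_complex_of_real of_real_divide)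
    have "l * J = (LINT z|lborel. W z) / pi"
      using weak[OF sA] unfolding 1 2 of_real_eq_iff .
    then show ?thesis
      by (simp add: field_simps)
  qed
  \<comment> \<open>A non-integrable function has integral 0 by convention, which the strictly
    positive value in \<open>energy\<close> excludes.\<close>
  have int_W: "integrable lborel W"
  proof (rule ccontr)
    assume "\<not> integrable lborel W"
    then have "pi * (l * J) = 0"
      unfolding energy by (rule not_integrable_integral_eq)
    then show False
      using J l by simp
  qed
  define S where "S v = s (of_real (sqrt v))" for v
  define S' where "S' v = (1 / (2 * sqrt v)) *\<^sub>R frechet_derivative s (at (of_real (sqrt v))) 1"
      for v
  have s_eq: "s z = S ((cmod z)\<^sup>2)" for z
    using S1_invariant_cmod[OF inv, of z] by (simp add: S_def)
  have S': "(S has_vector_derivative S' v) (at v)" if "0 < v" for v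
    unfolding S_def[abs_def] S'_def
    by (rule has_vector_derivative_along_ray[OF smooth_has_derivative[OF sms] that])
  have contS: "continuous_on UNIV S"
    unfolding S_def[abs_def] by (intro continuous_on_compose2[OF cs] continuous_intros) auto
  have dbar: "d_zbar s z = z * S' ((cmod z)\<^sup>2)" if "z \<noteq> 0" for z
  proof -
    have "s = (\<lambda>z. S ((cmod z)\<^sup>2))"
      using s_eq by auto
    then show ?thesis
      using d_zbar_radial[OF S', of z] that by simp
  qed
  \<comment> \<open>Written with \<open>d_zbar s\<close> rather than \<open>S'\<close>, which
    divides by sqrt v; this form is meaningful at v = 0 and visibly measurable.\<close>
  define e where "e v = (norm (d_zbar s (of_real (sqrt v))))\<^sup>2 * h\<^sub>0 v" for v
  have W_eq: "W z = e ((cmod z)\<^sup>2)" for z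
    unfolding W_def e_def h_def by (cases "z = 0") (auto simp: dbar norm_mult)
  have e_eq: "e v = v * h\<^sub>0 v * (norm (S' v))\<^sup>2" if "0 < v" for v
    unfolding e_def using that by (subst dbar) (auto simp: norm_mult power_mult_distrib)
  have meas_h: "h\<^sub>0 \<in> borel_measurable borel"
    unfolding h\<^sub>0_def[abs_def] E_def by measurable
  have meas_e: "e \<in> borel_measurable borel"
    unfolding e_def[abs_def]
    by (intro borel_measurable_times meas_h borel_measurable_continuous_onI continuous_intros
        continuous_on_compose2[OF smooth_imp_continuous_on[OF smooth_d_zbar[OF sms]]]) auto
  define G where "G v = (norm (S v - S (1 / K)))\<^sup>2 * (h\<^sub>0 v / (1 + v)\<^sup>2)" for v
  have meas_G: "G \<in> borel_measurable borel"
    unfolding G_def[abs_def]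
    by (intro borel_measurable_times borel_measurable_divide meas_h)
      (auto intro!: borel_measurable_continuous_onI continuous_intros contS)
  define a where "a = S (1 / K)"
  have G_eq: "G ((cmod z)\<^sup>2) / pi = wt z *\<^sub>R (norm (s z))\<^sup>2 - 2 * (a \<bullet> (wt z *\<^sub>R s z)) + (norm
      a)\<^sup>2 * (wt z *\<^sub>R 1)" for z
  proof -
    have *: "(norm (s z - a))\<^sup>2 = (norm (s z))\<^sup>2 - 2 * (a \<bullet> s z) + (norm a)\<^sup>2"
      unfolding power2_norm_eq_inner by (simp add: inner_diff inner_commute)
    have "G ((cmod z)\<^sup>2) / pi = wt z * (norm (s z - a))\<^sup>2"
      unfolding G_def wt_def h_def fubini_study_def s_eq[symmetric] a_def by (simp add: mult_ac)
    then show ?thesis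
      unfolding * by (simp add: algebra_simps)
  qed
  have int_G: "integrable lborel (\<lambda>z. G ((cmod z)\<^sup>2) / pi)"
    unfolding G_eq by (intro Bochner_Integration.integrable_add Bochner_Integration.integrable_diff
        integrable_mult_right integrable_inner_right int_s int_s2 int_1)
  \<comment> \<open>Expansion of the squared norm of s - a: the cross term is a multiple of the mean
    and vanishes.\<close>
  have "J \<le> J + (norm a)\<^sup>2 * (LINT z|lborel. wt z *\<^sub>R 1)"
    using wt_pos by (auto intro!: mult_nonneg_nonneg integral_nonneg_AE simp: less_imp_le)
  also have "\<dots> = (LINT z|lborel. G ((cmod z)\<^sup>2) / pi)"
  proof -
    have int_a: "integrable lborel (\<lambda>z. 2 * (a \<bullet> (wt z *\<^sub>R s z)))"
      by (intro integrable_mult_right integrable_inner_right int_s)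
    have "(LINT z|lborel. 2 * (a \<bullet> (wt z *\<^sub>R s z))) = 0"
      unfolding integral_mult_right_zero integral_inner_right[OF int_s] mean by simp
    then show ?thesis
      unfolding G_eq J_def
      by (subst Bochner_Integration.integral_add,
          intro Bochner_Integration.integrable_diff int_s2 int_a,
          intro integrable_mult_right int_1,
          subst Bochner_Integration.integral_diff[OF int_s2 int_a],
          simp only: integral_mult_right_zero diff_0_right)
  qed
  also have "\<dots> = (LINT v:{0..}|lborel. G v)"
    using integral_radial[OF meas_G] by simp
  finally have "lam * J \<le> lam * (LINT v:{0..}|lborel. G v)"
    using pos by simp
  also have "\<dots> \<le> (LINT v:{0..}|lborel. e v)"
    unfolding G_def
  proof (rule weighted_poincare[OF S' continuous_on_subset[OF contS] e_eq])
    show "set_integrable lborel {0..} e"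
      using int_W unfolding integrable_radial_iff[OF meas_e, symmetric] W_eq[abs_def] .
    have "integrable lborel (\<lambda>z::complex. G ((cmod z)\<^sup>2))"
      using integrable_mult_right[OF int_G, of pi] by simp
    then have "set_integrable lborel {0..} G"
      unfolding integrable_radial_iff[OF meas_G] .
    then show "set_integrable lborel {0..} (\<lambda>v. (norm (S v - S (1 / K)))\<^sup>2 * (h\<^sub>0 v / (1 + v)\<^sup>2))"
      unfolding G_def[abs_def] .
  qed auto
  also have "\<dots> = l * J"
    using energy integral_radial[OF meas_e] unfolding W_eq by simp
  finally show ?thesis
    using J by simp
qed

lemma lambda_1_eq: "lambda_1 m fubini_study h = lam"
  unfolding lambda_1_def
  by (rule Least_equality) (use invariant_eigenvalue_lam invariant_eigenvalue_ge_lam pos in auto)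

end

section \<open>Symplectic coordinates of the Fubini--Study form\<close>

lemma volume_form_fubini_study: "volume_form fubini_study"
proof -
  have sm: "smooth fubini_study"
    unfolding fubini_study_def[abs_def] by (intro smooth_intros) (use one_plus_cmod_square in auto)
  moreover have "fubini_study w = fubini_study (1 / w) / norm w ^ 4" if "w \<noteq> 0" for w
  proof -
    have "(1 + (1 / cmod w)\<^sup>2) * (cmod w)\<^sup>2 = 1 + (cmod w)\<^sup>2"
      using that by (simp add: field_simps)
    then have "(1 + (cmod w)\<^sup>2)\<^sup>2 = (1 + (1 / cmod w)\<^sup>2)\<^sup>2 * norm w ^ 4"
      by (metis (no_types) power_mult_distrib power_mult numeral_Bit0 mult_2)
    then show ?thesis
      unfolding fubini_study_def norm_divide norm_one by simp
  qed
  ultimately show ?thesis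
    unfolding volume_form_def using fubini_study_pos by blast
qed

lemma S1_invariant_fubini_study: "S1_invariant fubini_study"
  by (simp add: S1_invariant_def fubini_study_def norm_mult)

lemma total_mass_fubini_study: "total_mass fubini_study = 1"
proof -
  let ?f = "\<lambda>v::real. 1 / (pi * (1 + v)\<^sup>2)"
  have "((\<lambda>v. (- 1 / pi) * (1 / (1 + v))) has_real_derivative ?f v) (at v)" if "0 \<le> v" for v
  proof -
    have "((\<lambda>v. 1 / (1 + v)) has_real_derivative - 1 / (1 + v)\<^sup>2) (at v)"
      using that by (auto intro!: derivative_eq_intros simp: power2_eq_square)
    from DERIV_cmult[OF this, of "- 1 / pi"] show ?thesis
      by simp
  qed
  moreover have "((\<lambda>v::real. (- 1 / pi) * (1 / (1 + v))) \<longlongrightarrow> 0) at_top"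
    by real_asymp
  ultimately have "(LINT v:{0..}|lborel. ?f v) = 0 - (- 1 / pi) * (1 / (1 + 0))"
    by (intro integral_FTC_atLeast(2)) auto
  then show ?thesis
    unfolding total_mass_def fubini_study_def by (subst integral_radial) auto
qed

text \<open>The metric 1/(1 + |z|^2) shows that the choice is made from a nonempty set. Of the
  chosen metric only the defining properties are then available.\<close>

lemma potential_metric_fubini_study:
  "hermitian_metric 1 (potential_metric fubini_study)"
  "S1_invariant (potential_metric fubini_study)"
  "chern_form (potential_metric fubini_study) z = fubini_study z"
proof -
  define k where "k z = 1 / (1 + (cmod z)\<^sup>2)" for z
  have k_pos: "k z > 0" for z
    unfolding k_def using one_plus_cmod_square by simp
  have sm: "smooth k"
    unfolding k_def[abs_def] by (intro smooth_intros) (use one_plus_cmod_square in auto)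
  have "k w = k (1 / w) / norm w ^ (2 * 1)" if "w \<noteq> 0" for w
    unfolding k_def using that one_plus_cmod_square[of w]
    by (simp add: norm_divide power_divide divide_simps add.commute power2_eq_square)
  then have "hermitian_metric 1 k"
    unfolding hermitian_metric_def using sm k_pos by blast
  moreover have "S1_invariant k"
    by (simp add: S1_invariant_def k_def norm_mult)
  moreover have "chern_form k z = fubini_study z" for z
  proof -
    define L where "L v = complex_of_real (- ln (1 + v))" for v
    have L: "(L has_vector_derivative of_real (- 1 / (1 + v))) (at v)" if "0 \<le> v" for v
      unfolding L_def[abs_def] using that
      by (intro has_vector_derivative_of_real) (auto intro!: derivative_eq_intros simp: field_simps)
    have "complex_of_real (ln (k z)) = L ((cmod z)\<^sup>2)" for z
      unfolding k_def L_def using one_plus_cmod_square[of z] by (simp add: ln_div)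
    then have "d_zbar (\<lambda>z. complex_of_real (ln (k z))) =
        (\<lambda>z. z * complex_of_real (- 1 / (1 + (cmod z)\<^sup>2)))"
      using d_zbar_radial[OF L] by auto
    moreover have p: "((\<lambda>v. - 1 / (1 + v)) has_real_derivative 1 / (1 + (cmod z)\<^sup>2)\<^sup>2) (at ((cmod
        z)\<^sup>2))"
      using one_plus_cmod_square[of z] by (auto intro!: derivative_eq_intros simp: power2_eq_square)
    have "d_z (\<lambda>z. z * complex_of_real (- 1 / (1 + (cmod z)\<^sup>2))) z =
        of_real (- 1 / (1 + (cmod z)\<^sup>2) + (cmod z)\<^sup>2 * (1 / (1 + (cmod z)\<^sup>2)\<^sup>2))"
      unfolding d_z_eq[OF has_derivative_radial_mult[OF p]] radial_mult_deriv_d_z ..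
    moreover have "- 1 / (1 + (cmod z)\<^sup>2) + (cmod z)\<^sup>2 * (1 / (1 + (cmod z)\<^sup>2)\<^sup>2) =
        - 1 / (1 + (cmod z)\<^sup>2)\<^sup>2"
    proof -
      define y where "y = 1 + (cmod z)\<^sup>2"
      have y: "(cmod z)\<^sup>2 = y - 1" "y \<noteq> 0"
        using one_plus_cmod_square[of z] by (auto simp: y_def)
      then show ?thesis
        unfolding y_def[symmetric] y(1) using y(2) by (simp add: field_simps power2_eq_square)
    qed
    ultimately show ?thesis
      unfolding chern_form_def fubini_study_def by simp
  qed
  ultimately have "\<exists>k. hermitian_metric 1 k \<and> S1_invariant k \<and> (\<forall>z. chern_form k z =
      fubini_study z)"
    by blast
  from someI_ex[OF this] show "hermitian_metric 1 (potential_metric fubini_study)"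
    "S1_invariant (potential_metric fubini_study)"
    "chern_form (potential_metric fubini_study) z = fubini_study z"
    unfolding potential_metric_def by blast+
qed

text \<open>With n the v-derivative of the logarithm of k, the curvature equation reads (v n)' =
  -1/(1 + v)^2. Thus v n + v/(1 + v) is constant, and smoothness at the origin makes the constant 0.
  The scale of k disappears with the differentiation.\<close>

lemma potential_metric_log_derivative:
  fixes k :: "complex \<Rightarrow> real"
  assumes herm: "hermitian_metric n k" and inv: "S1_invariant k"
    and chern: "\<And>z. chern_form k z = fubini_study z" and v: "0 < v"
  shows "((\<lambda>v. ln (k (of_real (sqrt v)))) has_real_derivative - 1 / (1 + v)) (at v)"
proof -
  define L where "L z = ln (k z)" for z
  define g where "g z = complex_of_real (L z)" for z
  have smL: "smooth L" and smg: "smooth g"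
    using herm unfolding hermitian_metric_def g_def[abs_def] L_def[abs_def]
        by (auto intro!: smooth_intros)
  define DL where "DL z = frechet_derivative L (at z) 1" for z
  have smDL: "smooth DL"
    unfolding DL_def[abs_def] by (rule smooth_frechet_derivative[OF smL])
  define N where "N v = L (of_real (sqrt v))" for v
  define n where "n v = DL (of_real (sqrt v)) / (2 * sqrt v)" for v
  have N: "(N has_real_derivative n v) (at v)" if "0 < v" for v
    using has_vector_derivative_along_ray[OF smooth_has_derivative[OF smL] that]
    by (simp add: N_def[abs_def] n_def DL_def has_real_derivative_iff_has_vector_derivative)
  have L_eq: "L z = N ((cmod z)\<^sup>2)" for z
    using S1_invariant_cmod[OF inv, of z] by (simp add: L_def N_def)
  have dbar: "d_zbar g z = z * of_real (n ((cmod z)\<^sup>2))" if "z \<noteq> 0" for z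
  proof -
    have "g = (\<lambda>z. complex_of_real (N ((cmod z)\<^sup>2)))"
      using L_eq by (auto simp: g_def)
    then show ?thesis
      using d_zbar_radial[OF has_vector_derivative_of_real[OF N], of z] that by simp
  qed
  have n_diff: "\<exists>n'. (n has_real_derivative n') (at v)" if "0 < v" for v
  proof -
    have "\<exists>d. ((\<lambda>v. DL (of_real (sqrt v))) has_real_derivative d) (at v)"
      using has_vector_derivative_along_ray[OF smooth_has_derivative[OF smDL] that]
      unfolding has_real_derivative_iff_has_vector_derivative by blast
    then obtain d where d: "((\<lambda>v. DL (of_real (sqrt v))) has_real_derivative d) (at v)"
      by blast
    show ?thesis
      unfolding n_def[abs_def]
      by (rule exI, rule DERIV_divide[OF d], rule DERIV_cmult, rule DERIV_real_sqrt[OF that])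
        (use that in auto)
  qed
  have ode: "((\<lambda>v. v * n v) has_real_derivative - 1 / (1 + v)\<^sup>2) (at v)" if "0 < v" for v
  proof -
    obtain n' where n': "(n has_real_derivative n') (at v)"
      using n_diff[OF \<open>0 < v\<close>] by blast
    define z where "z = complex_of_real (sqrt v)"
    have z: "z \<noteq> 0" "(cmod z)\<^sup>2 = v"
      using that by (auto simp: z_def)
    have p: "(n has_real_derivative n') (at ((cmod z)\<^sup>2))"
      using n' z by simp
    have "(d_zbar g has_derivative radial_mult_deriv n n' z) (at z)"
      by (rule has_derivative_transform_within_open[OF has_derivative_radial_mult[OF p], of "-
          {0}"])
        (use z dbar in auto)
    from d_z_eq[OF this] have "d_z (d_zbar g) z = of_real (n v + v * n')"
      by (simp only: radial_mult_deriv_d_z z(2))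
    moreover have "chern_form k z = - Re (d_z (d_zbar g) z) / pi"
      by (simp add: chern_form_def g_def[abs_def] L_def)
    ultimately have "- (n v + v * n') / pi = 1 / (pi * (1 + v)\<^sup>2)"
      using chern[of z] by (simp add: fubini_study_def z(2))
    then have "n v + v * n' = - 1 / (1 + v)\<^sup>2"
      by (simp add: field_simps) 
    then show ?thesis
      using DERIV_mult[OF DERIV_ident n'] by (simp add: mult.commute add.commute)
  qed
  \<comment> \<open>This is v n(v) in a form that is continuous at v = 0 with value 0, although n
    itself contains a division by sqrt v.\<close>
  define M where "M v = sqrt v * Re (d_zbar g (of_real (sqrt v)))" for v
  have M_eq: "M v = v * n v" if "0 < v" for v
    unfolding M_def using that by (subst dbar) auto
  have "M v + v / (1 + v) = M 0 + 0 / (1 + 0)"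
  proof (rule DERIV_isconst_end[OF v])
    have "continuous_on UNIV M"
      unfolding M_def[abs_def]
      by (intro continuous_intros continuous_on_compose2[OF smooth_imp_continuous_on[OF
          smooth_d_zbar[OF smg]]]) auto
    then show "continuous_on {0..v} (\<lambda>v. M v + v / (1 + v))"
      by (intro continuous_intros) (auto intro: continuous_on_subset)
    fix x assume x: "0 < x" "x < v"
    have "(M has_real_derivative - 1 / (1 + x)\<^sup>2) (at x)"
      by (rule has_field_derivative_transform_within_open[OF ode[OF x(1)], of "{0<..}"])
        (use x M_eq in auto)
    moreover have "((\<lambda>v. v / (1 + v)) has_real_derivative 1 / (1 + x)\<^sup>2) (at x)"
      using x by (auto intro!: derivative_eq_intros simp: power2_eq_square)
    ultimately show "((\<lambda>v. M v + v / (1 + v)) has_real_derivative 0) (at x)"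
      using DERIV_add by fastforce
  qed
  then have "v * n v = v * (- 1 / (1 + v))"
    using M_eq[OF v] by (simp add: M_def)
  then have "n v = - 1 / (1 + v)"
    using v unfolding mult_cancel_left by simp
  then show ?thesis
    using N[OF v] by (simp add: N_def[abs_def] L_def)
qed

section \<open>The symplectic coordinate in closed form\<close>

lemma deriv_F_pot_fubini_study: "deriv (F_pot fubini_study) u = exp (- 2 * u) / (1 + exp (- 2 * u))"
proof -
  let ?k = "potential_metric fubini_study"
  note k = potential_metric_fubini_study
  \<comment> \<open>In v = exp (- 2 u) the potential is half the logarithm of the metric, and dv/du
    = - 2 v then turns -1/(1 + v) into v/(1 + v).\<close>
  have eq: "F_pot fubini_study = (\<lambda>u. ln (?k (of_real (sqrt (exp (- 2 * u))))) / 2)"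
  proof
    fix u :: real
    have "exp (- 2 * u) = (exp (- u))\<^sup>2"
      by (simp add: power2_eq_square exp_add[symmetric])
    then have "sqrt (exp (- 2 * u)) = exp (- u)"
      by simp
    moreover have "?k z > 0" for z
      using k(1) by (simp add: hermitian_metric_def)
    then have "ln (sqrt (?k z)) = ln (?k z) / 2" for z
      by (rule ln_sqrt[OF less_imp_le])
    ultimately show "F_pot fubini_study u = ln (?k (of_real (sqrt (exp (- 2 * u))))) / 2"
      by (simp add: F_pot_def)
  qed
  have "((\<lambda>u. ln (?k (of_real (sqrt (exp (- 2 * u)))))) has_real_derivative
      (- 1 / (1 + exp (- 2 * u))) * (exp (- 2 * u) * (- 2))) (at u)"
    by (rule DERIV_chain2[where f="\<lambda>v. ln (?k (of_real (sqrt v)))", OF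
        potential_metric_log_derivative[OF k]])
      (auto intro!: derivative_eq_intros)
  then have F: "(F_pot fubini_study has_real_derivative
      (- 1 / (1 + exp (- 2 * u))) * (exp (- 2 * u) * (- 2)) / 2) (at u)"
    unfolding eq by (rule DERIV_cdivide)
  have "(- 1 / (1 + y)) * (y * (- 2)) / 2 = y / (1 + y)" for y :: real
    by (cases "1 + y = 0") (simp_all add: divide_simps)
  then show ?thesis
    unfolding DERIV_imp_deriv[OF F] .
qed

text \<open>Solving v/(1 + v) = x gives v = x/(1 - x), and u is minus half the logarithm of
  v.\<close>

lemma G_inv_fubini_study:
  assumes "0 < x" "x < 1"
  shows "G_inv fubini_study x = - ln (x / (1 - x)) / 2"
  unfolding G_inv_def
proof (rule inv_into_f_eq)
  show "inj (deriv (F_pot fubini_study))"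
  proof (rule injI)
    fix a b assume "deriv (F_pot fubini_study) a = deriv (F_pot fubini_study) b"
    then have "exp (- 2 * a) * (1 + exp (- 2 * b)) = exp (- 2 * b) * (1 + exp (- 2 * a))"
      unfolding deriv_F_pot_fubini_study by (subst (asm) frac_eq_eq) (auto simp: add_pos_pos
          less_imp_neq[symmetric])
    then show "a = b"
      by (simp add: algebra_simps)
  qed
  have "exp (- 2 * (- ln (x / (1 - x)) / 2)) = x / (1 - x)"
    using assms by simp
  then show "deriv (F_pot fubini_study) (- ln (x / (1 - x)) / 2) = x"
    unfolding deriv_F_pot_fubini_study using assms by (simp add: field_simps)
qed simp

lemma gbar_fubini_study: "gbar fubini_study (1 / 2) = 1 / 2"
proof -
  have "((\<lambda>x::real. - ln (x / (1 - x)) / 2) has_real_derivative - 2) (at (1 / 2))"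
    by (auto intro!: derivative_eq_intros)
  then have "(G_inv fubini_study has_real_derivative - 2) (at (1 / 2))"
    by (rule has_field_derivative_transform_within_open[of _ _ _ "{0<..<1}"])
      (use G_inv_fubini_study in auto)
  then have "deriv (G_inv fubini_study) (1 / 2) = - 2"
    by (rule DERIV_imp_deriv)
  then show ?thesis
    by (simp add: gbar_def)
qed

lemma hbar_fubini_study: "hbar fubini_study h (1 / 2) = h 1"
  by (simp add: hbar_def G_inv_fubini_study)

section \<open>Letting the parameter tend to infinity\<close>

lemma exists_test_metric:
  fixes \<mu> :: real
  assumes "0 \<le> \<mu>"
  shows "\<exists>h. hermitian_metric m h \<and> S1_invariant h \<and> h 1 = \<mu> + 1 \<and> \<mu> \<le> lambda_1 m fubini_study h"
proof -
  \<comment> \<open>This choice meets the bound K \<ge> N and gives lam = K + N/K \<ge> K \<ge>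
    \<mu>.\<close>
  define K where "K = real m + 1 + \<mu>"
  \<comment> \<open>The metric with scale 1 is evaluated at z = 1 first; dividing by that value
    prescribes \<open>h 1\<close> without changing \<open>lam\<close>.\<close>
  define A where "A = (\<mu> + 1) / test_metric.h m K 1 1"
  have "test_metric m K 1"
    by unfold_locales (use assms in \<open>auto simp: K_def\<close>)
  then have h1: "0 < test_metric.h m K 1 1"
    by (rule test_metric.h_pos)
  interpret test_metric m K A
    by unfold_locales (use assms h1 in \<open>auto simp: K_def A_def\<close>)
  have "h 1 = A * test_metric.h m K 1 1"
    using \<open>test_metric m K 1\<close> test_metric_axioms
    by (simp add: h_def h\<^sub>0_def test_metric.h_def test_metric.h\<^sub>0_def E_def test_metric.E_def
        c_def test_metric.c_def N_def test_metric.N_def)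
  then have "h 1 = \<mu> + 1"
    using h1 by (simp add: A_def)
  moreover have "\<mu> \<le> lam"
  proof -
    have "\<mu> \<le> K"
      by (simp add: K_def)
    also have "K * K \<le> K\<^sup>2 + N"
      using pos by (simp add: power2_eq_square)
    then have "K \<le> lam"
      using pos by (simp add: lam_def pos_le_divide_eq)
    finally show ?thesis .
  qed
  ultimately show ?thesis
    using hermitian_metric_h S1_invariant_h lambda_1_eq by metis
qed

theorem mainTheorem2:
  fixes m :: nat
  shows "\<exists>(\<omega> :: real \<Rightarrow> complex \<Rightarrow> real) (h :: real \<Rightarrow> complex \<Rightarrow> real).
    (\<forall>\<mu>\<ge>0. volume_form (\<omega> \<mu>) \<and> S1_invariant (\<omega> \<mu>) \<and> total_mass (\<omega> \<mu>) = 1 \<and>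
            hermitian_metric m (h \<mu>) \<and> S1_invariant (h \<mu>)) \<and>
    ((\<lambda>\<mu>. SUP x\<in>{0<..<1}. ereal ((gbar (\<omega> \<mu>) x * hbar (\<omega> \<mu>) (h \<mu>) x) /
                                   (gbar_can x * hbar_inf m x))) \<longlongrightarrow> \<infinity>) at_top \<and>
    filterlim (\<lambda>\<mu>. lambda_1 m (\<omega> \<mu>) (h \<mu>)) at_top at_top"
proof -
  have "\<forall>\<mu>. \<exists>h. 0 \<le> \<mu> \<longrightarrow> hermitian_metric m h \<and> S1_invariant h \<and> h 1 = \<mu> + 1 \<and>
      \<mu> \<le> lambda_1 m fubini_study h"
    using exists_test_metric by blast
  from choice[OF this] obtain h where h: "\<And>\<mu>. 0 \<le> \<mu> \<Longrightarrow>
      hermitian_metric m (h \<mu>) \<and> S1_invariant (h \<mu>) \<and> h \<mu> 1 = \<mu> + 1 \<and>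
      \<mu> \<le> lambda_1 m fubini_study (h \<mu>)"
    by blast
  let ?q = "\<lambda>\<mu> x. gbar fubini_study x * hbar fubini_study (h \<mu>) x / (gbar_can x * hbar_inf m x)"
  \<comment> \<open>At x = 1/2 both \<open>gbar_can\<close> and \<open>hbar_inf\<close> equal 1 and
    \<open>gbar\<close> is 1/2, so the quotient is half of \<open>h \<mu> 1\<close>.\<close>
  have q: "?q \<mu> (1 / 2) = (\<mu> + 1) / 2" if "0 \<le> \<mu>" for \<mu>
    using h[OF that] by (simp add: gbar_fubini_study hbar_fubini_study gbar_can_def hbar_inf_def)
  have "((\<lambda>\<mu>. SUP x\<in>{0<..<1}. ereal (?q \<mu> x)) \<longlongrightarrow> \<infinity>) at_top"
    unfolding tendsto_PInfty
  proof
    fix r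
    show "eventually (\<lambda>\<mu>. ereal r < (SUP x\<in>{0<..<1}. ereal (?q \<mu> x))) at_top"
      using eventually_gt_at_top[of "max 0 (2 * r)"]
    proof eventually_elim
      case (elim \<mu>)
      then have "ereal r < ereal (?q \<mu> (1 / 2))"
        unfolding q[OF less_imp_le[OF le_less_trans[OF max.cobounded1 elim]]] by simp
      also have "\<dots> \<le> (SUP x\<in>{0<..<1}. ereal (?q \<mu> x))"
        by (rule SUP_upper) simp
      finally show ?case .
    qed
  qed
  moreover have "filterlim (\<lambda>\<mu>. lambda_1 m fubini_study (h \<mu>)) at_top at_top"
    by (rule filterlim_at_top_mono[OF filterlim_ident])
      (rule eventually_mono[OF eventually_ge_at_top[of 0]], use h in blast)
  ultimately show ?thesis
    by (intro exI[of _ "\<lambda>_. fubini_study"] exI[of _ h] conjI allI impI)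
      (simp_all add: h volume_form_fubini_study S1_invariant_fubini_study total_mass_fubini_study)
qed

end
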